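(* Let $\bar R\in(0,+\infty]$ and $\bar\sigma\in(-d,1)$. Let $\{R_n\}_{n\in\mathbb{N}}\subset(0,+\infty]$ and $\{\sigma_n\}_{n\in\mathbb{N}}\subset(-d,1)$ be such that $R_n\to\bar R$ and $\sigma_n\to\bar\sigma$ as $n\to+\infty$. Then: (i) ($\Gamma$-liminf inequality) For every $E\in\mathcal{M}_{\mathrm f}(\mathbb{R}^d)$ and every sequence $\{E_n\}_{n\in\mathbb{N}}\subset\mathcal{M}_{\mathrm f}(\mathbb{R}^d)$ with $\chi_{E_n}\to\chi_E$ strongly in $L^1(\mathbb{R}^d)$, $$\hat H^{\bar\sigma}_{\bar R}(E)\le\liminf_{n\to+\infty}\hat H^{\sigma_n}_{R_n}(E_n).$$ (ii) ($\Gamma$-limsup inequality) For every $E\in\mathcal{M}_{\mathrm f}(\mathbb{R}^d)$ there exists a sequence $\{E_n\}_{n\in\mathbb{N}}\subset\mathcal{M}_{\mathrm f}(\mathbb{R}^d)$ such that $\chi_{E_n}\to\chi_E$ strongly in $L^1(\mathbb{R}^d)$ and $$\hat H^{\bar\sigma}_{\bar R}(E)\ge\limsup_{n\to+\infty}\hat H^{\sigma_n}_{R_n}(E_n).$$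
   Context: Let $d\ge1$, let $|E|$ denote Lebesgue measure in $\mathbb{R}^d$, $\omega_d$ the measure of the unit ball, $B_\rho(x)$ the ball of radius $\rho$ and center $x$, and $\chi_E$ the characteristic function of $E$. $\mathcal{M}_{\mathrm f}(\mathbb{R}^d)$ is the family of measurable sets $E\subset\mathbb{R}^d$ with $|E|<+\infty$. For $\sigma\in(-d,1)$ and $R>0$ set $$\gamma^\sigma_R:=d\omega_d\frac{1-R^{-\sigma}}{\sigma}\ \text{ if }\sigma\ne0,\qquad \gamma^0_R:=d\omega_d\log R,$$ $$H^\sigma_R(E):=\int_E\int_{B_R(x)\setminus E}\frac{1}{|x-y|^{d+\sigma}}\,dy\,dx,\qquad \hat H^\sigma_R(E):=H^\sigma_R(E)-\gamma^\sigma_R|E|,\qquad E\in\mathcal{M}_{\mathrm f}(\mathbb{R}^d).$$ For $R=+\infty$ set $\hat H^\sigma_\infty:=\hat H^\sigma$, where, with $\gamma^\sigma:=\frac{d\omega_d}{\sigma}$ for $\sigma\neq0$: - for $\sigma\in(0,1)$, $\hat H^\sigma(E):=\int_E\int_{\mathbb{R}^d\setminus E}\frac{1}{|x-y|^{d+\sigma}}\,dy\,dx-\gamma^\sigma|E|$; - for $\sigma\in(-d,0)$, $\hat H^\sigma(E):=-\int_E\int_E\frac{1}{|x-y|^{d+\sigma}}\,dy\,dx-\gamma^\sigma|E|$; - for $\sigma=0$, $\hat H^0(E):=\int_E\int_{B_1(x)\setminus E}\frac{1}{|x-y|^{d}}\,dy\,dx-\int_E\int_{E\setminus B_1(x)}\frac{1}{|x-y|^{d}}\,dy\,dx$.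 These functionals take values in $(-\infty,+\infty]$. *)

theory Defs
  imports "HOL-Analysis.Analysis"
begin

text \<open>
  The space \<open>\<real>\<^sup>d\<close> is an arbitrary type of class \<open>euclidean_space\<close> with \<open>d = DIM('a)\<close>
  (so \<open>d \<ge> 1\<close> holds automatically). The measurable sets of finite measure are the
  library's \<open>lmeasurable\<close>. Double integrals of the nonnegative kernel are computed in
  \<open>ennreal\<close>; the renormalised functionals are \<open>ereal\<close>-valued.
\<close>

definition unit_ball_measure :: "'a::euclidean_space itself \<Rightarrow> real" where
  "unit_ball_measure _ = measure lebesgue (ball (0::'a) 1)"

definition gammaR :: "'a::euclidean_space itself \<Rightarrow> real \<Rightarrow> real \<Rightarrow> real" where
  "gammaR T \<sigma> R =
     (if \<sigma> = 0 then real DIM('a) * unit_ball_measure T * ln R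
      else real DIM('a) * unit_ball_measure T * ((1 - R powr (- \<sigma>)) / \<sigma>))"

text \<open>Only meaningful for \<open>\<sigma> \<noteq> 0\<close>, and only used there.\<close>

definition gamma_inf :: "'a::euclidean_space itself \<Rightarrow> real \<Rightarrow> real" where
  "gamma_inf T \<sigma> = real DIM('a) * unit_ball_measure T / \<sigma>"

text \<open>The junk value \<open>0\<close> on the diagonal is immaterial, the diagonal being a null set.\<close>

definition riesz_kernel :: "real \<Rightarrow> 'a::euclidean_space \<Rightarrow> 'a \<Rightarrow> ennreal" where
  "riesz_kernel \<sigma> x y = ennreal (1 / norm (x - y) powr (real DIM('a) + \<sigma>))"

definition H_R :: "real \<Rightarrow> real \<Rightarrow> 'a::euclidean_space set \<Rightarrow> ennreal" where
  "H_R \<sigma> R E =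
     (\<integral>\<^sup>+x\<in>E. (\<integral>\<^sup>+y\<in>ball x R - E. riesz_kernel \<sigma> x y \<partial>lebesgue) \<partial>lebesgue)"

definition Hhat_R :: "real \<Rightarrow> real \<Rightarrow> 'a::euclidean_space set \<Rightarrow> ereal" where
  "Hhat_R \<sigma> R E =
     enn2ereal (H_R \<sigma> R E) - ereal (gammaR TYPE('a) \<sigma> R * measure lebesgue E)"

text \<open>
  For \<open>E\<close> of finite measure the double integrals that are subtracted below are finite, so
  the \<open>ereal\<close> subtractions never have the form \<open>\<infinity> - \<infinity>\<close>.
\<close>

definition Hhat_inf :: "real \<Rightarrow> 'a::euclidean_space set \<Rightarrow> ereal" where
  "Hhat_inf \<sigma> E =
     (if \<sigma> > 0 then
        enn2ereal (\<integral>\<^sup>+x\<in>E. (\<integral>\<^sup>+y\<in>- E. riesz_kernel \<sigma> x y \<partial>lebesgue) \<partial>lebesgue)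
          - ereal (gamma_inf TYPE('a) \<sigma> * measure lebesgue E)
      else if \<sigma> < 0 then
        - enn2ereal (\<integral>\<^sup>+x\<in>E. (\<integral>\<^sup>+y\<in>E. riesz_kernel \<sigma> x y \<partial>lebesgue) \<partial>lebesgue)
          - ereal (gamma_inf TYPE('a) \<sigma> * measure lebesgue E)
      else
        enn2ereal (\<integral>\<^sup>+x\<in>E. (\<integral>\<^sup>+y\<in>ball x 1 - E. riesz_kernel 0 x y \<partial>lebesgue) \<partial>lebesgue)
          - enn2ereal (\<integral>\<^sup>+x\<in>E. (\<integral>\<^sup>+y\<in>E - ball x 1. riesz_kernel 0 x y \<partial>lebesgue) \<partial>lebesgue))"

definition Hhat :: "real \<Rightarrow> ereal \<Rightarrow> 'a::euclidean_space set \<Rightarrow> ereal" where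
  "Hhat \<sigma> R E = (if R = \<infinity> then Hhat_inf \<sigma> E else Hhat_R \<sigma> (real_of_ereal R) E)"

definition L1_converges :: "(nat \<Rightarrow> 'a::euclidean_space \<Rightarrow> real) \<Rightarrow> ('a \<Rightarrow> real) \<Rightarrow> bool" where
  "L1_converges f g \<longleftrightarrow>
     (\<lambda>n. \<integral>\<^sup>+x. ennreal \<bar>f n x - g x\<bar> \<partial>lebesgue) \<longlonglongrightarrow> 0"

end

theory Submission
  imports Defs
begin

text \<open>
  Let \<open>p(z) = |{x \<in> E. x + z \<notin> E}|\<close> and \<open>c(z) = |E| - p(z)\<close>. In polar coordinates \<open>\<gamma>\<^sub>R - \<gamma>\<^sub>r\<close> is
  the integral of the kernel \<open>k(z) = |z| powr - (d + \<sigma>)\<close> over \<open>r \<le> |z| < R\<close>, so for every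
  \<open>r < min 1 R\<close> all the definitions of the functional, including those for \<open>R = \<infinity>\<close>, take the form
  \<open>\<integral>\<^bsub>|z| < r\<^esub> k p - \<gamma>\<^sub>r |E| - \<integral>\<^bsub>r \<le> |z| < R\<^esub> k c\<close>. The kernel of the last integral is bounded by
  \<open>r powr - (d + 1)\<close>, hence the last two terms are continuous in \<open>(\<sigma>, R, E)\<close> jointly. They bound the
  functional from below and increase to it as \<open>r\<close> decreases to \<open>0\<close>, which gives the liminf inequality.

  For the limsup inequality only the singular term matters. Let \<open>u\<close> be the convolution of the
  indicator of \<open>E\<close> with that of a ball of radius \<open>\<epsilon>\<close> and volume \<open>\<beta>\<close>. By the coarea formula the
  average over \<open>t \<in> [0, \<beta>]\<close> of the singular terms of \<open>{u > t}\<close> is \<open>\<integral>\<^bsub>|z| < r\<^esub> k q / \<beta>\<close> with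
  \<open>q(z) = \<integral> (u(x) - u(x + z))\<^sup>+ dx\<close>. Since \<open>q \<le> \<beta> p\<close>, the average is at most the singular term of \<open>E\<close>;
  since also \<open>q(z) \<le> C |z|\<close>, it is continuous in \<open>\<sigma> < 1\<close>. So some level \<open>t\<close> away from \<open>0\<close> and \<open>\<beta>\<close> is good
  for \<open>\<sigma>\<^sub>n\<close>, and \<open>{u > t}\<close> is close to \<open>E\<close> when \<open>\<epsilon>\<close> is small. A diagonal choice concludes.
\<close>

section \<open>Radial integrals\<close>

text \<open>Polar coordinates for radial functions, without a surface measure: on half-lines
  \<open>{..a}\<close> one side is the volume of a ball, the other follows from the fundamental
  theorem of calculus, and half-lines form a generator closed under intersection.\<close>

lemma distr_norm_lborel:
  "distr lborel borel (norm :: 'a::euclidean_space \<Rightarrow> real) =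
     density lborel (\<lambda>s. ennreal (real DIM('a) * unit_ball_vol DIM('a) * s ^ (DIM('a) - 1)) * indicator {0..} s)"
  (is "?M = ?N")
proof (rule measure_eqI_generator_eq[where E = "range atMost" and \<Omega> = UNIV and A = "\<lambda>n. {..real n}"])
  let ?w = "unit_ball_vol DIM('a)" and ?d = "DIM('a)"
  show "Int_stable (range (atMost :: real \<Rightarrow> _))"
    by (auto simp: Int_stable_def)
  show "sets ?M = sigma_sets UNIV (range atMost)" "sets ?N = sigma_sets UNIV (range atMost)"
    by (simp_all add: borel_eq_atMost)
  have M: "emeasure ?M {..a} = (if a < 0 then 0 else ennreal (?w * a ^ ?d))" for a :: real
  proof -
    have "norm -` {..a} = cball (0::'a) a"
      by auto
    then show ?thesis
      by (simp add: emeasure_distr emeasure_cball)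
  qed
  have N: "emeasure ?N {..a} = (if a < 0 then 0 else ennreal (?w * a ^ ?d))" for a :: real
  proof -
    have "emeasure ?N {..a} =
        (\<integral>\<^sup>+s. ennreal (?d * ?w * s ^ (?d - 1)) * indicator {0..a} s \<partial>lborel)"
      by (simp add: emeasure_density mult.assoc)
         (auto intro!: nn_integral_cong split: split_indicator)
    also have "\<dots> = (if a < 0 then 0 else ennreal (?w * a ^ ?d))"
    proof (cases "a < 0")
      case False
      have "(\<integral>\<^sup>+s. ennreal (?d * ?w * s ^ (?d - 1)) * indicator {0..a} s \<partial>lborel)
          = ?w * a ^ ?d - ?w * 0 ^ ?d"
        using False
        by (intro nn_integral_FTC_Icc) (auto intro!: derivative_eq_intros)
      then show ?thesis using False by simp
    qed simp
    finally show ?thesis .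
  qed
  show "emeasure ?M X = emeasure ?N X" if "X \<in> range atMost" for X
    using that M N by auto
  show "emeasure ?M {..real n} \<noteq> \<infinity>" for n
    by (simp add: M)
  show "(\<Union>n. {..real n}) = UNIV"
    by (auto intro: real_arch_simple)
qed auto

lemma nn_integral_radial:
  assumes [measurable]: "f \<in> borel_measurable borel"
  shows "(\<integral>\<^sup>+z. f (norm (z::'a::euclidean_space)) \<partial>lborel) =
    (\<integral>\<^sup>+s. ennreal (real DIM('a) * unit_ball_vol DIM('a) * s ^ (DIM('a) - 1)) * indicator {0..} s * f s \<partial>lborel)"
proof -
  have "(\<integral>\<^sup>+z. f (norm (z::'a)) \<partial>lborel) = (\<integral>\<^sup>+s. f s \<partial>distr lborel borel (norm :: 'a \<Rightarrow> real))"
    by (simp add: nn_integral_distr)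
  also have "\<dots> = (\<integral>\<^sup>+s. ennreal (real DIM('a) * unit_ball_vol DIM('a) * s ^ (DIM('a) - 1)) * indicator {0..} s * f s \<partial>lborel)"
    unfolding distr_norm_lborel by (simp add: nn_integral_density)
  finally show ?thesis .
qed

section \<open>Kernel masses of annuli, exteriors and balls\<close>

text \<open>The Riesz kernel as a real function of the difference \<open>z = y - x\<close>. Its
  default value at the origin is 0.\<close>

definition rker :: "real \<Rightarrow> 'a::euclidean_space \<Rightarrow> real" where
  "rker s z = 1 / norm z powr (real DIM('a) + s)"

lemma rker_measurable [measurable]: "rker s \<in> borel_measurable borel"
  unfolding rker_def by measurable

lemma rker_nonneg [simp]: "0 \<le> rker s z"
  by (simp add: rker_def)

lemma unit_ball_measure_eq: "unit_ball_measure TYPE('a::euclidean_space) = unit_ball_vol DIM('a)"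
  by (simp add: unit_ball_measure_def content_ball)

lemma radial_weight:
  assumes "s > 0" "d > 0"
  shows "s ^ (d - 1) * (1 / s powr (real d + \<sigma>)) = s powr (- \<sigma> - 1)"
proof -
  have "s ^ (d - 1) = s powr (real d - 1)"
    using assms by (simp add: powr_realpow[symmetric] of_nat_diff)
  then have "s ^ (d - 1) * (1 / s powr (real d + \<sigma>)) = s powr (real d - 1 + - (real d + \<sigma>))"
    by (simp only: powr_add powr_minus_divide)
  also have "real d - 1 + - (real d + \<sigma>) = - \<sigma> - 1"
    by simp
  finally show ?thesis .
qed

text \<open>The density is the kernel times the area of the sphere of radius \<open>x\<close>, so
  \<open>gammaR\<close> is a primitive of it for every \<sigma>, the logarithmic case included.
  Differences of \<open>gammaR\<close> are therefore kernel masses of annuli.\<close>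

lemma gammaR_has_derivative:
  assumes "x > 0"
  shows "((\<lambda>s. gammaR TYPE('a::euclidean_space) \<sigma> s) has_real_derivative
    real DIM('a) * unit_ball_vol DIM('a) * x powr (- \<sigma> - 1)) (at x)"
proof (cases "\<sigma> = 0")
  case True
  then show ?thesis
    using assms unfolding gammaR_def unit_ball_measure_eq
    by (auto intro!: derivative_eq_intros simp: powr_minus field_simps)
next
  case False
  then show ?thesis
    using assms unfolding gammaR_def unit_ball_measure_eq
    by (auto intro!: derivative_eq_intros)
qed

lemma nn_integral_rker_radial:
  assumes [measurable]: "S \<in> sets borel" and "S \<subseteq> {0<..}"
  shows "(\<integral>\<^sup>+z. ennreal (rker \<sigma> (z::'a::euclidean_space)) * indicator S (norm z) \<partial>lborel) =
    (\<integral>\<^sup>+s. ennreal (real DIM('a) * unit_ball_vol DIM('a) * s powr (- \<sigma> - 1)) * indicator S s \<partial>lborel)"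
proof -
  let ?c = "real DIM('a) * unit_ball_vol DIM('a)"
  have "(\<integral>\<^sup>+z. ennreal (rker \<sigma> (z::'a)) * indicator S (norm z) \<partial>lborel) =
      (\<integral>\<^sup>+s. ennreal (?c * s ^ (DIM('a) - 1)) * indicator {0..} s *
        (ennreal (1 / s powr (real DIM('a) + \<sigma>)) * indicator S s) \<partial>lborel)"
    unfolding rker_def by (subst nn_integral_radial[symmetric]) simp_all
  also have "\<dots> = (\<integral>\<^sup>+s. ennreal (?c * s powr (- \<sigma> - 1)) * indicator S s \<partial>lborel)"
  proof (intro nn_integral_cong)
    fix s :: real
    show "ennreal (?c * s ^ (DIM('a) - 1)) * indicator {0..} s *
        (ennreal (1 / s powr (real DIM('a) + \<sigma>)) * indicator S s) =
        ennreal (?c * s powr (- \<sigma> - 1)) * indicator S s"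
    proof (cases "s \<in> S")
      case True
      then have "s > 0" using assms by auto
      then show ?thesis
        using True radial_weight[of s "DIM('a)" \<sigma>, symmetric]
        by (simp add: ennreal_mult'[symmetric])
    qed simp
  qed
  finally show ?thesis .
qed

lemma nn_integral_rker_annulus:
  assumes "0 < r" "r \<le> R"
  shows "(\<integral>\<^sup>+z. ennreal (rker \<sigma> (z::'a::euclidean_space)) * indicator {r..<R} (norm z) \<partial>lborel) =
    ennreal (gammaR TYPE('a) \<sigma> R - gammaR TYPE('a) \<sigma> r)"
proof -
  let ?c = "real DIM('a) * unit_ball_vol DIM('a)"
  have "(\<integral>\<^sup>+z. ennreal (rker \<sigma> (z::'a)) * indicator {r..<R} (norm z) \<partial>lborel) =
      (\<integral>\<^sup>+s. ennreal (?c * s powr (- \<sigma> - 1)) * indicator {r..<R} s \<partial>lborel)"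
    using assms by (intro nn_integral_rker_radial) auto
  \<comment> \<open>The fundamental theorem is applied on a closed interval; the added endpoint is a
    null set.\<close>
  also have "\<dots> = (\<integral>\<^sup>+s. ennreal (?c * s powr (- \<sigma> - 1)) * indicator {r..R} s \<partial>lborel)"
    using AE_lborel_singleton[of R]
    by (intro nn_integral_cong_AE) (auto split: split_indicator)
  also have "\<dots> = ennreal (gammaR TYPE('a) \<sigma> R - gammaR TYPE('a) \<sigma> r)"
    using assms by (intro nn_integral_FTC_Icc) (auto intro!: gammaR_has_derivative)
  finally show ?thesis .
qed

text \<open>For \<sigma> > 0 the power \<open>R powr - \<sigma>\<close> vanishes at infinity, so
  \<open>gamma_inf\<close> is the value of the primitive \<open>gammaR\<close> at infinite
  radius.\<close>

lemma nn_integral_rker_outside: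
  assumes "0 < r" "0 < \<sigma>"
  shows "(\<integral>\<^sup>+z. ennreal (rker \<sigma> (z::'a::euclidean_space)) * indicator {r..} (norm z) \<partial>lborel) =
    ennreal (gamma_inf TYPE('a) \<sigma> - gammaR TYPE('a) \<sigma> r)"
proof -
  let ?c = "real DIM('a) * unit_ball_vol DIM('a)"
  have "((\<lambda>R. R powr - \<sigma>) \<longlongrightarrow> 0) at_top"
    using assms by (intro tendsto_neg_powr filterlim_ident) auto
  then have "((\<lambda>R. ?c * ((1 - R powr - \<sigma>) / \<sigma>)) \<longlongrightarrow> ?c * ((1 - 0) / \<sigma>)) at_top"
    using assms by (intro tendsto_intros) auto
  then have lim: "((\<lambda>R. gammaR TYPE('a) \<sigma> R) \<longlongrightarrow> gamma_inf TYPE('a) \<sigma>) at_top"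
    using assms by (simp add: gammaR_def gamma_inf_def unit_ball_measure_eq)
  have "(\<integral>\<^sup>+z. ennreal (rker \<sigma> (z::'a)) * indicator {r..} (norm z) \<partial>lborel) =
      (\<integral>\<^sup>+s. ennreal (?c * s powr (- \<sigma> - 1)) * indicator {r..} s \<partial>lborel)"
    using assms by (intro nn_integral_rker_radial) auto
  also have "\<dots> = ennreal (gamma_inf TYPE('a) \<sigma> - gammaR TYPE('a) \<sigma> r)"
    using assms lim by (intro nn_integral_FTC_atLeast) (auto intro!: gammaR_has_derivative)
  finally show ?thesis .
qed

lemma rker_zero [simp]: "rker \<sigma> 0 = 0"
  by (simp add: rker_def)

lemma gammaR_1 [simp]: "gammaR T \<sigma> 1 = 0"
  by (simp add: gammaR_def)

text \<open>Monotone convergence along annuli whose inner radius shrinks to 0. The weight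
  \<open>g\<close> is 1 when a kernel mass is computed and a correlation when the near part of the
  functional is recovered.\<close>

lemma nn_integral_rker_inside_SUP:
  fixes g :: "'a::euclidean_space \<Rightarrow> ennreal"
  assumes "0 < r" and [measurable]: "g \<in> borel_measurable borel"
  shows "(\<integral>\<^sup>+z. ennreal (rker \<sigma> z) * indicator {..<r} (norm z) * g z \<partial>lborel) =
    (SUP n. \<integral>\<^sup>+z. ennreal (rker \<sigma> z) * indicator {r / (real n + 1)..<r} (norm z) * g z \<partial>lborel)"
proof -
  let ?a = "\<lambda>n::nat. r / (real n + 1)"
  have "ennreal (rker \<sigma> z) * indicator {..<r} (norm z) =
      (SUP n. ennreal (rker \<sigma> z) * indicator {?a n..<r} (norm z))" for z :: 'a
  \<comment> \<open>At the origin both sides vanish by the default value of \<open>rker\<close>; for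
    \<open>norm z \<ge> r\<close> all indicators vanish.\<close>
  proof (cases "z = 0 \<or> norm z \<ge> r")
    case False
    then obtain n :: nat where n: "r / norm z < real n"
      using reals_Archimedean2 by blast
    then have "?a n \<le> norm z"
      using False \<open>0 < r\<close> by (simp add: field_simps) (smt (verit) norm_ge_zero)
    then have "ennreal (rker \<sigma> z) * indicator {..<r} (norm z) \<le> (SUP n. ennreal (rker \<sigma> z) * indicator {?a n..<r} (norm z))"
      using False by (intro SUP_upper2[of n]) auto
    moreover have "(SUP n. ennreal (rker \<sigma> z) * indicator {?a n..<r} (norm z)) \<le> ennreal (rker \<sigma> z) * indicator {..<r} (norm z)"
      by (intro SUP_least) (auto split: split_indicator)
    ultimately show ?thesis by (rule antisym)
  qed auto
  then have "(\<integral>\<^sup>+z. ennreal (rker \<sigma> z) * indicator {..<r} (norm z) * g z \<partial>lborel) =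
      (\<integral>\<^sup>+z. (SUP n. ennreal (rker \<sigma> z) * indicator {?a n..<r} (norm z) * g z) \<partial>lborel)"
    by (simp add: SUP_mult_right_ennreal)
  also have "\<dots> = (SUP n. \<integral>\<^sup>+z. ennreal (rker \<sigma> z) * indicator {?a n..<r} (norm z) * g z \<partial>lborel)"
  proof (rule nn_integral_monotone_convergence_SUP)
    have "?a n \<le> ?a m" if "m \<le> n" for m n
      using that \<open>0 < r\<close> by (intro divide_left_mono) auto
    then show "incseq (\<lambda>n z. ennreal (rker \<sigma> z) * indicator {?a n..<r} (norm z) * g z)"
      by (auto simp: incseq_def le_fun_def split: split_indicator) (meson order_trans)
  qed auto
  finally show ?thesis .
qed

text \<open>For \<sigma> < 0 the kernel is integrable at the origin, and \<open>gamma_inf\<close> is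
  the limit of the primitive \<open>gammaR\<close> at radius 0.\<close>

lemma nn_integral_rker_inside:
  assumes "0 < r" "\<sigma> < 0"
  shows "(\<integral>\<^sup>+z. ennreal (rker \<sigma> (z::'a::euclidean_space)) * indicator {..<r} (norm z) \<partial>lborel) =
    ennreal (gammaR TYPE('a) \<sigma> r - gamma_inf TYPE('a) \<sigma>)"
proof -
  let ?c = "real DIM('a) * unit_ball_vol DIM('a)"
  let ?a = "\<lambda>n::nat. r / (real n + 1)"
  have "(\<integral>\<^sup>+z. ennreal (rker \<sigma> (z::'a)) * indicator {..<r} (norm z) \<partial>lborel) =
      (SUP n. \<integral>\<^sup>+z. ennreal (rker \<sigma> (z::'a)) * indicator {?a n..<r} (norm z) \<partial>lborel)"
    using nn_integral_rker_inside_SUP[of r "\<lambda>_::'a. 1" \<sigma>] \<open>0 < r\<close> by simp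
  also have "\<dots> = (SUP n. ennreal (gammaR TYPE('a) \<sigma> r - gammaR TYPE('a) \<sigma> (?a n)))"
  proof (intro SUP_cong refl)
    fix n
    show "(\<integral>\<^sup>+z. ennreal (rker \<sigma> (z::'a)) * indicator {?a n..<r} (norm z) \<partial>lborel) =
      ennreal (gammaR TYPE('a) \<sigma> r - gammaR TYPE('a) \<sigma> (?a n))"
      using \<open>0 < r\<close> by (intro nn_integral_rker_annulus) (auto simp: field_simps)
  qed
  also have "\<dots> = ennreal (gammaR TYPE('a) \<sigma> r - gamma_inf TYPE('a) \<sigma>)"
  proof (rule LIMSEQ_unique[OF LIMSEQ_SUP])
    have "(\<lambda>n. r / (real n + 1)) \<longlonglongrightarrow> 0"
      using LIMSEQ_Suc[OF lim_const_over_n[of r]] by (simp add: add.commute)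
    then have "(\<lambda>n. ?a n powr - \<sigma>) \<longlonglongrightarrow> 0"
      using \<open>0 < r\<close> \<open>\<sigma> < 0\<close>  tendsto_powr'[of ?a 0 sequentially "\<lambda>_. - \<sigma>" "- \<sigma>"] by auto
    then have "(\<lambda>n. ?c * ((1 - ?a n powr - \<sigma>) / \<sigma>)) \<longlonglongrightarrow> ?c * ((1 - 0) / \<sigma>)"
      using assms by (intro tendsto_intros) auto
    then have "(\<lambda>n. gammaR TYPE('a) \<sigma> (?a n)) \<longlonglongrightarrow> gamma_inf TYPE('a) \<sigma>"
      using assms by (simp add: gammaR_def gamma_inf_def unit_ball_measure_eq)
    then show "(\<lambda>n. ennreal (gammaR TYPE('a) \<sigma> r - gammaR TYPE('a) \<sigma> (?a n)))
        \<longlonglongrightarrow> ennreal (gammaR TYPE('a) \<sigma> r - gamma_inf TYPE('a) \<sigma>)"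
      by (intro tendsto_intros)
    show "incseq (\<lambda>n. ennreal (gammaR TYPE('a) \<sigma> r - gammaR TYPE('a) \<sigma> (?a n)))"
    proof (intro incseq_SucI ennreal_leI)
      fix n
      have "?a (Suc n) \<le> ?a n"
        using \<open>0 < r\<close> by (simp add: field_simps)
      then have "?a (Suc n) powr - \<sigma> \<le> ?a n powr - \<sigma>"
        using assms by (intro powr_mono2) auto
      then have "(1 - ?a (Suc n) powr - \<sigma>) / \<sigma> \<le> (1 - ?a n powr - \<sigma>) / \<sigma>"
        using \<open>\<sigma> < 0\<close> by (intro divide_right_mono_neg) auto
      then have "?c * ((1 - ?a (Suc n) powr - \<sigma>) / \<sigma>) \<le> ?c * ((1 - ?a n powr - \<sigma>) / \<sigma>)"
        by (intro mult_left_mono) auto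
      then show "gammaR TYPE('a) \<sigma> r - gammaR TYPE('a) \<sigma> (?a n) \<le>
        gammaR TYPE('a) \<sigma> r - gammaR TYPE('a) \<sigma> (?a (Suc n))"
        using \<open>\<sigma> < 0\<close> by (simp add: gammaR_def unit_ball_measure_eq del: of_nat_Suc)
    qed
  qed
  finally show ?thesis .
qed

text \<open>Spheres are null by the radial formula. This removes the radius at which a moving
  cut-off may fail to converge.\<close>

lemma AE_lborel_norm_neq: "AE z in lborel. norm (z::'a::euclidean_space) \<noteq> c"
proof -
  have "emeasure lborel {z::'a. norm z = c} = (\<integral>\<^sup>+z. indicator {c} (norm (z::'a)) \<partial>lborel)"
    by (simp flip: nn_integral_indicator add: indicator_def)
  also have "\<dots> = (\<integral>\<^sup>+s. ennreal (real DIM('a) * unit_ball_vol DIM('a) * s ^ (DIM('a) - 1)) * indicator {0..} s * indicator {c} s \<partial>lborel)"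
    by (rule nn_integral_radial) simp
  also have "\<dots> = (\<integral>\<^sup>+s. 0 \<partial>(lborel :: real measure))"
  proof (rule nn_integral_cong_AE)
    show "AE s in lborel. ennreal (real DIM('a) * unit_ball_vol DIM('a) * s ^ (DIM('a) - 1)) *
        indicator {0..} s * indicator {c} s = 0"
      using AE_lborel_singleton[of c] by eventually_elim simp
  qed
  finally show ?thesis
    by (intro AE_I'[of "{z. norm z = c}"]) (auto simp: null_sets_def)
qed

section \<open>Correlations and the decomposition of the functional\<close>

lemma nn_integral_lborel_translate:
  fixes c :: "'a::euclidean_space"
  assumes [measurable]: "f \<in> borel_measurable borel"
  shows "(\<integral>\<^sup>+x. f (x + c) \<partial>lborel) = (\<integral>\<^sup>+x. f x \<partial>lborel)"
proof -
  have "(\<integral>\<^sup>+x. f x \<partial>lborel) = (\<integral>\<^sup>+x. f x \<partial>distr lborel borel ((+) c))"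
    by (simp add: lborel_distr_plus)
  then show ?thesis
    by (simp add: nn_integral_distr add.commute)
qed

text \<open>The measure of \<open>A \<inter> (B - z)\<close>, a cross covariogram:
  \<open>corr E (- E)\<close> and \<open>corr E E\<close> are the functions p and c of the
  introductory text.\<close>

definition corr :: "'a::euclidean_space set \<Rightarrow> 'a set \<Rightarrow> 'a \<Rightarrow> ennreal" where
  "corr A B z = (\<integral>\<^sup>+x. indicator A x * indicator B (x + z) \<partial>lborel)"

lemma corr_measurable [measurable]:
  assumes [measurable]: "A \<in> sets borel" "B \<in> sets borel"
  shows "corr A B \<in> borel_measurable borel"
  unfolding corr_def by measurable

lemma corr_le:
  assumes [measurable]: "A \<in> sets borel"
  shows "corr A B z \<le> emeasure lborel A"
proof -
  have "corr A B z \<le> (\<integral>\<^sup>+x. indicator A x \<partial>lborel)"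
    unfolding corr_def by (intro nn_integral_mono) (auto split: split_indicator)
  then show ?thesis by simp
qed

lemma corr_compl:
  assumes [measurable]: "A \<in> sets borel" "B \<in> sets borel"
  shows "corr A B z + corr A (- B) z = emeasure lborel A"
proof -
  have "corr A B z + corr A (- B) z =
      (\<integral>\<^sup>+x. indicator A x * indicator B (x + z) + indicator A x * indicator (- B) (x + z) \<partial>lborel)"
    unfolding corr_def by (intro nn_integral_add[symmetric]) measurable
  also have "\<dots> = (\<integral>\<^sup>+x. indicator A x \<partial>lborel)"
    by (intro nn_integral_cong) (auto split: split_indicator)
  finally have "corr A B z + corr A (- B) z = (\<integral>\<^sup>+x. indicator A x \<partial>lborel)" .
  then show ?thesis by simp
qed

lemma corr_eq_emeasure:
  assumes [measurable]: "A \<in> sets borel" "B \<in> sets borel"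
  shows "corr A B z = emeasure lborel {x \<in> A. x + z \<in> B}"
proof -
  have "corr A B z = (\<integral>\<^sup>+x. indicator {x \<in> A. x + z \<in> B} x \<partial>lborel)"
    unfolding corr_def by (intro nn_integral_cong) (auto split: split_indicator)
  then show ?thesis
    by simp
qed

text \<open>Substituting \<open>y = x + z\<close> and exchanging the integrals reduces a double
  integral of a difference kernel to one integral against a correlation.\<close>

lemma nn_integral_corr_weighted:
  fixes g :: "'a::euclidean_space \<Rightarrow> ennreal"
  assumes [measurable]: "A \<in> sets borel" "B \<in> sets borel" "g \<in> borel_measurable borel"
  shows "(\<integral>\<^sup>+x. (\<integral>\<^sup>+y. g (y - x) * indicator B y \<partial>lborel) * indicator A x \<partial>lborel) =
    (\<integral>\<^sup>+z. g z * corr A B z \<partial>lborel)"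
proof -
  have "(\<integral>\<^sup>+y. g (y - x) * indicator B y \<partial>lborel) = (\<integral>\<^sup>+z. g z * indicator B (x + z) \<partial>lborel)" for x
    by (subst nn_integral_lborel_translate[symmetric, where c = x]) (simp_all add: add.commute)
  then have "(\<integral>\<^sup>+x. (\<integral>\<^sup>+y. g (y - x) * indicator B y \<partial>lborel) * indicator A x \<partial>lborel) =
     (\<integral>\<^sup>+x. (\<integral>\<^sup>+z. g z * (indicator A x * indicator B (x + z)) \<partial>lborel) \<partial>lborel)"
    by (simp add: nn_integral_cmult[symmetric] mult.commute mult.left_commute)
  also have "\<dots> = (\<integral>\<^sup>+z. (\<integral>\<^sup>+x. g z * (indicator A x * indicator B (x + z)) \<partial>lborel) \<partial>lborel)"
    by (intro lborel_pair.Fubini') measurable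
  also have "\<dots> = (\<integral>\<^sup>+z. g z * corr A B z \<partial>lborel)"
    unfolding corr_def by (intro nn_integral_cong nn_integral_cmult) measurable
  finally show ?thesis .
qed

lemma nn_integral_corr:
  assumes [measurable]: "A \<in> sets borel" "B \<in> sets borel"
  shows "(\<integral>\<^sup>+z. corr A B z \<partial>lborel) = emeasure lborel A * emeasure lborel B"
  using nn_integral_corr_weighted[OF assms, of "\<lambda>_. 1"]
  by (simp add: nn_integral_cmult nn_integral_multc mult.commute)

definition interaction :: "real \<Rightarrow> real set \<Rightarrow> 'a::euclidean_space set \<Rightarrow> 'a set \<Rightarrow> ennreal" where
  "interaction \<sigma> S A B =
     (\<integral>\<^sup>+z. ennreal (rker \<sigma> z) * indicator S (norm z) * corr A B z \<partial>lborel)"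

lemma nn_integral_riesz:
  assumes [measurable]: "A \<in> sets borel" "B \<in> sets borel" "S \<in> sets borel"
  shows "(\<integral>\<^sup>+x\<in>A. (\<integral>\<^sup>+y\<in>{y \<in> B. norm (x - y) \<in> S}. riesz_kernel \<sigma> x y \<partial>lebesgue) \<partial>lebesgue) =
    interaction \<sigma> S A B"
proof -
  have "riesz_kernel \<sigma> x y * indicator {y \<in> B. norm (x - y) \<in> S} y =
      ennreal (rker \<sigma> (y - x)) * indicator S (norm (y - x)) * indicator B y" for x y :: 'a
    by (auto simp: riesz_kernel_def rker_def norm_minus_commute split: split_indicator)
  then show ?thesis
    unfolding nn_integral_completion interaction_def
    by (simp add: nn_integral_corr_weighted[of A B "\<lambda>z. ennreal (rker \<sigma> z) * indicator S (norm z)"])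
qed

lemma interaction_Un:
  assumes [measurable]: "A \<in> sets borel" "B \<in> sets borel" "S \<in> sets borel" "T \<in> sets borel"
    and "S \<inter> T = {}"
  shows "interaction \<sigma> (S \<union> T) A B = interaction \<sigma> S A B + interaction \<sigma> T A B"
  unfolding interaction_def
  using assms(5)
  by (subst nn_integral_add[symmetric])
     (auto intro!: nn_integral_cong split: split_indicator)

text \<open>The two correlations add up to the constant \<open>|A|\<close>. This exchanges
  interaction with a set for interaction with its complement, at the price of a kernel mass that
  \<open>gammaR\<close> computes.\<close>

lemma interaction_compl:
  fixes A B :: "'a::euclidean_space set"
  assumes [measurable]: "A \<in> sets borel" "B \<in> sets borel" "S \<in> sets borel"
  shows "interaction \<sigma> S A B + interaction \<sigma> S A (- B) =
    emeasure lborel A * (\<integral>\<^sup>+z. ennreal (rker \<sigma> (z::'a)) * indicator S (norm z) \<partial>lborel)"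
proof -
  have "interaction \<sigma> S A B + interaction \<sigma> S A (- B) =
      (\<integral>\<^sup>+z. ennreal (rker \<sigma> z) * indicator S (norm z) * (corr A B z + corr A (- B) z) \<partial>lborel)"
    unfolding interaction_def by (simp add: nn_integral_add distrib_left)
  then show ?thesis
    by (simp add: corr_compl nn_integral_cmult mult.commute)
qed

text \<open>Since \<open>r < 1\<close>, the power \<open>r powr a\<close> decreases in
  \<open>a\<close>; since the exponent \<open>DIM('a) + \<sigma>\<close> is positive, the kernel
  decreases in \<open>norm z\<close>. The bound is uniform in \<sigma>.\<close>

lemma rker_le:
  fixes z :: "'a::euclidean_space"
  assumes "0 < r" "r < 1" "- real DIM('a) < \<sigma>" "\<sigma> < 1" "r \<le> norm z"
  shows "rker \<sigma> z \<le> 1 / r powr (real DIM('a) + 1)"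
proof -
  have "r powr (real DIM('a) + 1) \<le> r powr (real DIM('a) + \<sigma>)"
    using assms by (intro powr_mono') auto
  also have "\<dots> \<le> norm z powr (real DIM('a) + \<sigma>)"
    using assms by (intro powr_mono2) auto
  finally show ?thesis
    unfolding rker_def using assms by (intro divide_left_mono mult_pos_pos) auto
qed

text \<open>The integral of a correlation over all \<open>z\<close> is the product of the two
  measures, and the kernel is bounded at distances in \<open>S\<close>.\<close>

lemma interaction_far_le:
  fixes A :: "'a::euclidean_space set"
  assumes [measurable]: "A \<in> sets borel" "B \<in> sets borel" "S \<in> sets borel"
    and "0 < r" "r < 1" "- real DIM('a) < \<sigma>" "\<sigma> < 1" "S \<subseteq> {r..}"
  shows "interaction \<sigma> S A B \<le> ennreal (1 / r powr (real DIM('a) + 1)) * (emeasure lborel A * emeasure lborel B)"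
proof -
  have "interaction \<sigma> S A B \<le> (\<integral>\<^sup>+z. ennreal (1 / r powr (real DIM('a) + 1)) * corr A B z \<partial>lborel)"
    unfolding interaction_def
  proof (intro nn_integral_mono mult_right_mono)
    fix z :: 'a
    have "ennreal (rker \<sigma> z) \<le> ennreal (1 / r powr (real DIM('a) + 1))" if "norm z \<in> S"
      using assms that by (intro ennreal_leI rker_le) auto
    then show "ennreal (rker \<sigma> z) * indicator S (norm z) \<le> ennreal (1 / r powr (real DIM('a) + 1))"
      by (auto split: split_indicator)
  qed simp
  also have "\<dots> = ennreal (1 / r powr (real DIM('a) + 1)) * (emeasure lborel A * emeasure lborel B)"
    by (simp add: nn_integral_cmult nn_integral_corr)
  finally show ?thesis .
qed

section \<open>Splitting the functional at a small radius\<close>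

text \<open>The outer radius is an extended real, so one formula covers finite radii and
  \<infinity>.\<close>

definition cut_range :: "real \<Rightarrow> ereal \<Rightarrow> real set" where
  "cut_range r R = {s. r \<le> s \<and> ereal s < R}"

lemma cut_range_measurable [measurable]: "cut_range r R \<in> sets borel"
  unfolding cut_range_def by measurable

text \<open>On sets of finite measure the interaction is finite for \<open>0 < r < 1\<close> and
  admissible \<sigma>, so \<open>enn2real\<close> loses nothing and infinite values can only come
  from the near part.\<close>

definition far_part :: "real \<Rightarrow> real \<Rightarrow> ereal \<Rightarrow> 'a::euclidean_space set \<Rightarrow> real" where
  "far_part \<sigma> r R E =
     - gammaR TYPE('a) \<sigma> r * measure lborel E - enn2real (interaction \<sigma> (cut_range r R) E E)"

lemma gammaR_mono:
  assumes "0 < r" "r \<le> R"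
  shows "gammaR TYPE('a::euclidean_space) \<sigma> r \<le> gammaR TYPE('a) \<sigma> R"
proof (rule DERIV_nonneg_imp_nondecreasing[OF assms(2)])
  fix x assume "r \<le> x" "x \<le> R"
  then show "\<exists>y. ((\<lambda>s. gammaR TYPE('a) \<sigma> s) has_real_derivative y) (at x) \<and> 0 \<le> y"
    using assms
    by (intro exI[of _ "real DIM('a) * unit_ball_vol DIM('a) * x powr (- \<sigma> - 1)"] conjI
        gammaR_has_derivative) auto
qed

lemma gammaR_le_gamma_inf:
  assumes "0 < r" "0 < \<sigma>"
  shows "gammaR TYPE('a::euclidean_space) \<sigma> r \<le> gamma_inf TYPE('a) \<sigma>"
  using assms unfolding gammaR_def gamma_inf_def unit_ball_measure_eq
  by (auto simp: field_simps)

lemma gamma_inf_le_gammaR: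
  assumes "0 < r" "\<sigma> < 0"
  shows "gamma_inf TYPE('a::euclidean_space) \<sigma> \<le> gammaR TYPE('a) \<sigma> r"
  using assms unfolding gammaR_def gamma_inf_def unit_ball_measure_eq
  by (auto simp: field_simps)

lemma ennreal_add_eqE:
  assumes "x + y = ennreal q" "0 \<le> q"
  obtains a b where "x = ennreal a" "y = ennreal b" "0 \<le> a" "0 \<le> b" "a + b = q"
proof -
  have "x < top" "y < top"
    using assms by (auto simp: less_top[symmetric])
  then obtain a b where "x = ennreal a" "y = ennreal b" "0 \<le> a" "0 \<le> b"
    by (metis ennreal_cases less_top)
  with assms show thesis
    by (intro that[of a b]) (auto simp flip: ennreal_plus)
qed

text \<open>A finite kernel mass makes both interactions finite, so the exchange between them
  becomes an identity of reals.\<close>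

lemma interaction_splitE:
  fixes E :: "'a::euclidean_space set"
  assumes [measurable]: "E \<in> sets borel" "S \<in> sets borel" and fin: "emeasure lborel E < \<infinity>"
    and "(\<integral>\<^sup>+z. ennreal (rker \<sigma> (z::'a)) * indicator S (norm z) \<partial>lborel) = ennreal q" "0 \<le> q"
  obtains a b where "interaction \<sigma> S E E = ennreal a" "interaction \<sigma> S E (- E) = ennreal b"
    "0 \<le> a" "0 \<le> b" "a + b = measure lborel E * q"
proof -
  have "interaction \<sigma> S E E + interaction \<sigma> S E (- E) = ennreal (measure lborel E * q)"
    using assms by (simp add: interaction_compl emeasure_eq_ennreal_measure ennreal_mult)
  then show thesis
    using that \<open>0 \<le> q\<close> by (elim ennreal_add_eqE) auto
qed

text \<open>Trading interaction with \<open>E\<close> for interaction with \<open>- E\<close> on a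
  suitable range of distances changes the value by \<open>|E|\<close> times a difference of
  \<open>gammaR\<close> or \<open>gamma_inf\<close>. In every case only the constant
  \<open>gammaR\<close> at \<open>r\<close> remains.\<close>

lemma Hhat_decomp:
  fixes E :: "'a::euclidean_space set"
  assumes [measurable]: "E \<in> sets borel" and fin: "emeasure lborel E < \<infinity>"
    and r: "0 < r" "r < 1" "ereal r < R" and s: "- real DIM('a) < \<sigma>" "\<sigma> < 1"
  shows "Hhat \<sigma> R E = enn2ereal (interaction \<sigma> {..<r} E (- E)) + ereal (far_part \<sigma> r R E)"
proof -
  let ?I = "\<lambda>S B. interaction \<sigma> S E B"
  let ?\<gamma> = "gammaR TYPE('a) \<sigma>" and ?\<gamma>' = "gamma_inf TYPE('a) \<sigma>"
  let ?m = "measure lborel E"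
  have mleb: "measure lebesgue E = ?m"
    by (simp add: measure_def)
  have eq: "(\<integral>\<^sup>+x\<in>E. (\<integral>\<^sup>+y\<in>T x. riesz_kernel \<sigma> x y \<partial>lebesgue) \<partial>lebesgue) = ?I S B"
    if "B \<in> sets borel" "S \<in> sets borel" "\<And>x. T x = {y \<in> B. norm (x - y) \<in> S}" for T S B
    using that by (simp add: nn_integral_riesz)
  have Un: "?I S B = ?I T B + ?I U B"
    if "S = T \<union> U" "T \<inter> U = {}" "B \<in> sets borel" "T \<in> sets borel" "U \<in> sets borel" for S T U B
    using that by (simp add: interaction_Un)
  have [measurable]: "- E \<in> sets borel" by measurable
  consider (fin) R' where "R = ereal R'" "r < R'" | (inf) "R = \<infinity>"
    using r by (cases R) auto
  then show ?thesis
  proof cases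
    case fin
    have cut: "cut_range r R = {r..<R'}"
      by (auto simp: cut_range_def fin)
    obtain a b where ab: "?I {r..<R'} E = ennreal a" "?I {r..<R'} (- E) = ennreal b"
      "0 \<le> a" "0 \<le> b" "a + b = ?m * (?\<gamma> R' - ?\<gamma> r)"
      using interaction_splitE[OF assms(1) _ assms(2) nn_integral_rker_annulus] r fin
      by (metis atLeastLessThan_borel diff_ge_0_iff_ge gammaR_mono less_eq_real_def)
    have "H_R \<sigma> R' E = ?I {..<R'} (- E)"
      unfolding H_R_def by (rule eq) (auto simp: dist_norm)
    also have "\<dots> = ?I {..<r} (- E) + ?I {r..<R'} (- E)"
      using fin by (intro Un) auto
    finally have H: "H_R \<sigma> R' E = ?I {..<r} (- E) + ennreal b"
      by (simp add: ab)
    \<comment> \<open>Here \<open>b\<close> is \<open>|E|\<close> times the kernel mass minus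
      \<open>a\<close>, which cancels the constant at \<open>R'\<close>. The near part may be
      infinite, hence the case split.\<close>
    have "enn2ereal (?I {..<r} (- E) + ennreal b) - ereal (?\<gamma> R' * ?m) =
      enn2ereal (?I {..<r} (- E)) + ereal (- ?\<gamma> r * ?m - a)"
      using ab(3-5)
      by (cases "?I {..<r} (- E)") (auto simp: plus_ennreal.rep_eq algebra_simps)
    then show ?thesis
      using fin ab by (simp add: Hhat_def Hhat_R_def H mleb far_part_def cut[unfolded fin])
  next
    case inf
    have cut: "cut_range r \<infinity> = {r..}"
      by (auto simp: cut_range_def)
    consider "\<sigma> > 0" | "\<sigma> < 0" | "\<sigma> = 0" by linarith
    then show ?thesis
    proof cases
      \<comment> \<open>The exterior has finite kernel mass, so the argument for finite radius
        applies with \<open>gamma_inf\<close> in place of the constant at \<open>R'\<close>.\<close>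
      case 1
      obtain a b where ab: "?I {r..} E = ennreal a" "?I {r..} (- E) = ennreal b"
        "0 \<le> a" "0 \<le> b" "a + b = ?m * (?\<gamma>' - ?\<gamma> r)"
        using interaction_splitE[OF assms(1) _ assms(2) nn_integral_rker_outside[OF r(1) 1]]
          gammaR_le_gamma_inf[OF r(1) 1] by (metis atLeast_borel diff_ge_0_iff_ge)
      have "(\<integral>\<^sup>+x\<in>E. (\<integral>\<^sup>+y\<in>- E. riesz_kernel \<sigma> x y \<partial>lebesgue) \<partial>lebesgue) = ?I UNIV (- E)"
        by (rule eq) auto
      also have "\<dots> = ?I {..<r} (- E) + ?I {r..} (- E)"
        by (intro Un) auto
      finally have H: "(\<integral>\<^sup>+x\<in>E. (\<integral>\<^sup>+y\<in>- E. riesz_kernel \<sigma> x y \<partial>lebesgue) \<partial>lebesgue) = ?I {..<r} (- E) + ennreal b"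
        by (simp add: ab)
      have "enn2ereal (?I {..<r} (- E) + ennreal b) - ereal (?\<gamma>' * ?m) =
        enn2ereal (?I {..<r} (- E)) + ereal (- ?\<gamma> r * ?m - a)"
        using ab(3-5)
        by (cases "?I {..<r} (- E)") (auto simp: plus_ennreal.rep_eq algebra_simps)
      then show ?thesis
        using inf 1 ab by (simp add: Hhat_def Hhat_inf_def H mleb far_part_def cut)
    next
      \<comment> \<open>The kernel has finite mass near the origin, so the trade takes place inside
        the ball of radius \<open>r\<close>; the self-interaction \<open>c\<close> beyond
        \<open>r\<close> already has the required form.\<close>
      case 2
      obtain a b where ab: "?I {..<r} E = ennreal a" "?I {..<r} (- E) = ennreal b"
        "0 \<le> a" "0 \<le> b" "a + b = ?m * (?\<gamma> r - ?\<gamma>')"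
        using interaction_splitE[OF assms(1) _ assms(2) nn_integral_rker_inside[OF r(1) 2]]
          gamma_inf_le_gammaR[OF r(1) 2] by (metis lessThan_borel diff_ge_0_iff_ge)
      have "?I {r..} E \<le> ennreal (1 / r powr (real DIM('a) + 1)) * (emeasure lborel E * emeasure lborel E)"
        using r s by (intro interaction_far_le) auto
      also have "\<dots> < top"
        using assms(2) by (auto simp: ennreal_mult_less_top)
      finally obtain c where c: "?I {r..} E = ennreal c" "0 \<le> c"
        by (metis ennreal_cases less_irrefl)
      have "(\<integral>\<^sup>+x\<in>E. (\<integral>\<^sup>+y\<in>E. riesz_kernel \<sigma> x y \<partial>lebesgue) \<partial>lebesgue) = ?I UNIV E"
        by (rule eq) auto
      also have "\<dots> = ?I {..<r} E + ?I {r..} E"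
        by (intro Un) auto
      finally have H: "(\<integral>\<^sup>+x\<in>E. (\<integral>\<^sup>+y\<in>E. riesz_kernel \<sigma> x y \<partial>lebesgue) \<partial>lebesgue) = ennreal (a + c)"
        using ab(3) c(2) by (simp add: ab c)
      have "- (a + c) - ?\<gamma>' * ?m = b + (- ?\<gamma> r * ?m - c)"
        using ab(3-5) by (simp add: algebra_simps)
      then have "- ereal (a + c) - ereal (?\<gamma>' * ?m) = ereal b + ereal (- ?\<gamma> r * ?m - c)"
        by simp
      moreover have "enn2ereal (ennreal (a + c)) = ereal (a + c)"
        using ab(3) c(2) by (simp del: ennreal_plus)
      ultimately have "- enn2ereal (ennreal (a + c)) - ereal (?\<gamma>' * ?m) = ereal b + ereal (- ?\<gamma> r * ?m - c)"
        by simp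
      then show ?thesis
        using inf 2 ab c by (simp add: Hhat_def Hhat_inf_def H mleb far_part_def cut del: ennreal_plus)
    next
      \<comment> \<open>The kernel mass diverges at both ends, so the trade is confined to distances
        between \<open>r\<close> and 1, and \<open>gammaR\<close> vanishes at 1.\<close>
      case 3
      obtain a b where ab: "?I {r..<1} E = ennreal a" "?I {r..<1} (- E) = ennreal b"
        "0 \<le> a" "0 \<le> b" "a + b = ?m * (?\<gamma> 1 - ?\<gamma> r)"
        using interaction_splitE[OF assms(1) _ assms(2) nn_integral_rker_annulus, of r 1] r
        by (metis atLeastLessThan_borel diff_ge_0_iff_ge gammaR_mono less_eq_real_def)
      have "?I {1..} E \<le> ennreal (1 / r powr (real DIM('a) + 1)) * (emeasure lborel E * emeasure lborel E)"
        using r s by (intro interaction_far_le) auto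
      also have "\<dots> < top"
        using assms(2) by (auto simp: ennreal_mult_less_top)
      finally obtain c where c: "?I {1..} E = ennreal c" "0 \<le> c"
        by (metis ennreal_cases less_irrefl)
      have "(\<integral>\<^sup>+x\<in>E. (\<integral>\<^sup>+y\<in>ball x 1 - E. riesz_kernel \<sigma> x y \<partial>lebesgue) \<partial>lebesgue) = ?I {..<1} (- E)"
        by (rule eq) (auto simp: dist_norm)
      also have "\<dots> = ?I {..<r} (- E) + ?I {r..<1} (- E)"
        using r by (intro Un) auto
      finally have H1: "(\<integral>\<^sup>+x\<in>E. (\<integral>\<^sup>+y\<in>ball x 1 - E. riesz_kernel \<sigma> x y \<partial>lebesgue) \<partial>lebesgue) = ?I {..<r} (- E) + ennreal b"
        by (simp add: ab)
      have H2: "(\<integral>\<^sup>+x\<in>E. (\<integral>\<^sup>+y\<in>E - ball x 1. riesz_kernel \<sigma> x y \<partial>lebesgue) \<partial>lebesgue) = ennreal c"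
        unfolding c(1)[symmetric] by (rule eq) (auto simp: dist_norm)
      have "?I {r..} E = ?I {r..<1} E + ?I {1..} E"
        using r by (intro Un) auto
      then have far: "?I {r..} E = ennreal (a + c)"
        using ab c by simp
      have "enn2ereal (?I {..<r} (- E) + ennreal b) - ereal c =
        enn2ereal (?I {..<r} (- E)) + ereal (- ?\<gamma> r * ?m - (a + c))"
        using ab(3-5)
        by (cases "?I {..<r} (- E)") (auto simp: plus_ennreal.rep_eq algebra_simps)
      then show ?thesis
        using inf 3 ab c H1 H2
        by (simp add: Hhat_def Hhat_inf_def mleb far_part_def cut far[unfolded 3] del: ennreal_plus)
    qed
  qed
qed

section \<open>Liminf inequality\<close>

text \<open>At \<sigma> = 0 the power branch is the difference quotient of
  \<open>- (r powr - s)\<close> at 0, whose limit is \<open>ln r\<close>; so the two branches of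
  \<open>gammaR\<close> fit together.\<close>

lemma isCont_gammaR:
  assumes "0 < r"
  shows "isCont (\<lambda>s. gammaR TYPE('a::euclidean_space) s r) \<sigma>"
proof (cases "\<sigma> = 0")
  case True
  let ?c = "real DIM('a) * unit_ball_vol DIM('a)"
  have "((\<lambda>s. - (r powr - s)) has_real_derivative ln r) (at 0)"
    using assms by (auto intro!: derivative_eq_intros)
  then have "(\<lambda>s. (1 - r powr - s) / s) \<midarrow>0\<rightarrow> ln r"
    using assms by (simp add: DERIV_def)
  then have "(\<lambda>s. ?c * ((1 - r powr - s) / s)) \<midarrow>0\<rightarrow> ?c * ln r"
    by (intro tendsto_intros)
  then have "(\<lambda>s. gammaR TYPE('a) s r) \<midarrow>0\<rightarrow> ?c * ln r"
    by (rule Lim_transform_eventually)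
       (auto simp: eventually_at gammaR_def unit_ball_measure_eq intro!: exI[of _ 1])
  then show ?thesis
    by (simp add: True isCont_def gammaR_def unit_ball_measure_eq)
next
  case False
  let ?f = "\<lambda>s. real DIM('a) * unit_ball_vol DIM('a) * ((1 - r powr - s) / s)"
  have cont: "isCont ?f \<sigma>"
    using False assms by (intro continuous_intros) auto
  have ev: "\<forall>\<^sub>F s in nhds \<sigma>. gammaR TYPE('a) s r = ?f s"
    using t1_space_nhds[OF False] by eventually_elim (simp add: gammaR_def unit_ball_measure_eq)
  show ?thesis
    using cont unfolding isCont_cong[OF ev] .
qed

text \<open>A pair in \<open>A \<times> A\<close> lies in \<open>B \<times> B\<close>, or its first
  point is in \<open>A - B\<close>, or its first point is in \<open>B\<close> and its second in
  \<open>A - B\<close>.\<close>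

lemma interaction_mono_set:
  fixes A B :: "'a::euclidean_space set"
  assumes [measurable]: "A \<in> sets borel" "B \<in> sets borel" "S \<in> sets borel"
  shows "interaction \<sigma> S A A \<le>
    interaction \<sigma> S B B + (interaction \<sigma> S (A - B) A + interaction \<sigma> S B (A - B))"
proof -
  let ?k = "\<lambda>z::'a. ennreal (rker \<sigma> z) * indicator S (norm z)"
  have corr: "corr A A z \<le> corr B B z + (corr (A - B) A z + corr B (A - B) z)" for z
  proof -
    have "corr A A z \<le> (\<integral>\<^sup>+x. indicator B x * indicator B (x + z) +
       (indicator (A - B) x * indicator A (x + z) + indicator B x * indicator (A - B) (x + z)) \<partial>lborel)"
      unfolding corr_def by (intro nn_integral_mono) (auto split: split_indicator)
    also have "\<dots> = corr B B z + (corr (A - B) A z + corr B (A - B) z)"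
      unfolding corr_def by (simp add: nn_integral_add)
    finally show ?thesis .
  qed
  have "interaction \<sigma> S A A \<le> (\<integral>\<^sup>+z. ?k z * (corr B B z + (corr (A - B) A z + corr B (A - B) z)) \<partial>lborel)"
    unfolding interaction_def using corr by (intro nn_integral_mono mult_left_mono) auto
  also have "\<dots> = interaction \<sigma> S B B + (interaction \<sigma> S (A - B) A + interaction \<sigma> S B (A - B))"
    unfolding interaction_def by (simp add: nn_integral_add distrib_left)
  finally show ?thesis .
qed

lemma interaction_far_finite:
  fixes A :: "'a::euclidean_space set"
  assumes "A \<in> sets borel" "B \<in> sets borel" "S \<in> sets borel"
    and "0 < r" "r < 1" "- real DIM('a) < \<sigma>" "\<sigma> < 1" "S \<subseteq> {r..}"
    and "emeasure lborel A < \<infinity>" "emeasure lborel B < \<infinity>"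
  shows "interaction \<sigma> S A B < \<infinity>"
  using assms(9,10)
  by (intro order.strict_trans1[OF interaction_far_le[OF assms(1-8)]])
     (auto simp: ennreal_mult_less_top)

text \<open>One half of a Lipschitz estimate in the set; exchanging \<open>A\<close> and
  \<open>B\<close> gives the other half. The constant depends only on \<open>r\<close> and the
  dimension, hence is uniform in \<sigma> and \<open>S\<close>.\<close>

lemma interaction_diff_le:
  fixes A B :: "'a::euclidean_space set"
  assumes [measurable]: "A \<in> sets borel" "B \<in> sets borel" "S \<in> sets borel"
    and r: "0 < r" "r < 1" "- real DIM('a) < \<sigma>" "\<sigma> < 1" "S \<subseteq> {r..}"
    and fin: "emeasure lborel A < \<infinity>" "emeasure lborel B < \<infinity>"
  shows "enn2real (interaction \<sigma> S A A) \<le> enn2real (interaction \<sigma> S B B) +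
    1 / r powr (real DIM('a) + 1) * (measure lborel (A - B) * (measure lborel A + measure lborel B))"
proof -
  let ?C = "1 / r powr (real DIM('a) + 1)"
  have fin': "emeasure lborel (A - B) < \<infinity>"
    using emeasure_mono[of "A - B" A lborel] fin by (auto intro: order.strict_trans1)
  have far: "interaction \<sigma> S D F \<le> ennreal (?C * (measure lborel D * measure lborel F))"
    if "D \<in> sets borel" "F \<in> sets borel" "emeasure lborel D < \<infinity>" "emeasure lborel F < \<infinity>" for D F :: "'a set"
    using interaction_far_le[of D F S r \<sigma>] that r
    by (simp add: emeasure_eq_ennreal_measure ennreal_mult'[symmetric] ennreal_mult''[symmetric])
  have "interaction \<sigma> S A A \<le> interaction \<sigma> S B B + (interaction \<sigma> S (A - B) A + interaction \<sigma> S B (A - B))"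
    by (rule interaction_mono_set) measurable
  also have "\<dots> \<le> interaction \<sigma> S B B + (ennreal (?C * (measure lborel (A - B) * measure lborel A)) +
      ennreal (?C * (measure lborel B * measure lborel (A - B))))"
    using fin fin' by (intro add_left_mono add_mono far) auto
  also have "\<dots> = ennreal (enn2real (interaction \<sigma> S B B) +
      ?C * (measure lborel (A - B) * (measure lborel A + measure lborel B)))"
    using interaction_far_finite[of B B S r \<sigma>] r fin
    by (simp add: algebra_simps add_divide_distrib)
  finally show ?thesis
    by (intro enn2real_leI) auto
qed

lemma rker_tendsto:
  assumes "\<sigma> \<longlonglongrightarrow> \<sigma>'"
  shows "(\<lambda>n. rker (\<sigma> n) z) \<longlonglongrightarrow> rker \<sigma>' z"
proof (cases "z = 0")
  case False
  then show ?thesis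
    unfolding rker_def using assms by (intro tendsto_intros) auto
qed simp

text \<open>Dominated convergence; the majorant is a multiple of \<open>corr E E\<close>, whose
  integral is the square of \<open>|E|\<close>.\<close>

lemma interaction_tendsto:
  fixes E :: "'a::euclidean_space set"
  assumes [measurable]: "E \<in> sets borel" and fin: "emeasure lborel E < \<infinity>"
    and r: "0 < r" "r < 1" "\<And>n. - real DIM('a) < \<sigma> n" "\<And>n. \<sigma> n < 1"
    and lim: "\<sigma> \<longlonglongrightarrow> \<sigma>'" "R \<longlonglongrightarrow> R'"
  shows "(\<lambda>n. interaction (\<sigma> n) (cut_range r (R n)) E E) \<longlonglongrightarrow> interaction \<sigma>' (cut_range r R') E E"
  unfolding interaction_def
proof (rule nn_integral_dominated_convergence)
  let ?C = "1 / r powr (real DIM('a) + 1)"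
  show "AE z in lborel. ennreal (rker (\<sigma> n) z) * indicator (cut_range r (R n)) (norm z) * corr E E z
      \<le> ennreal ?C * corr E E z" for n
  proof (intro AE_I2 mult_right_mono)
    fix z :: 'a
    have "ennreal (rker (\<sigma> n) z) \<le> ennreal ?C" if "norm z \<ge> r"
      using r that by (intro ennreal_leI rker_le) auto
    then show "ennreal (rker (\<sigma> n) z) * indicator (cut_range r (R n)) (norm z) \<le> ennreal ?C"
      by (auto simp: cut_range_def split: split_indicator)
  qed auto
  show "(\<integral>\<^sup>+z. ennreal ?C * corr E E z \<partial>lborel) < \<infinity>"
    using fin by (simp add: nn_integral_cmult nn_integral_corr ennreal_mult_less_top)
  \<comment> \<open>For infinite \<open>R'\<close> the condition is trivial and
    \<open>real_of_ereal R'\<close> is only a default value.\<close>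
  have "AE z in lborel. ereal (norm (z::'a)) \<noteq> R'"
    using AE_lborel_norm_neq[of "real_of_ereal R'"] by eventually_elim auto
  then show "AE z in lborel. (\<lambda>n. ennreal (rker (\<sigma> n) z) * indicator (cut_range r (R n)) (norm z) * corr E E z)
      \<longlonglongrightarrow> ennreal (rker \<sigma>' z) * indicator (cut_range r R') (norm z) * corr E E z"
  proof eventually_elim
    \<comment> \<open>Off the limiting sphere, membership in the cut range is eventually constant,
      so only the kernel still varies with \<open>n\<close>.\<close>
    fix z :: 'a assume z: "ereal (norm z) \<noteq> R'"
    have "\<forall>\<^sub>F n in sequentially. ereal (norm z) < R n \<longleftrightarrow> ereal (norm z) < R'"
    proof (cases "ereal (norm z) < R'")
      case True
      then show ?thesis
        using order_tendstoD(1)[OF lim(2) True] by (auto elim!: eventually_mono)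
    next
      case False
      then have "R' < ereal (norm z)"
        using z by auto
      from order_tendstoD(2)[OF lim(2) this] show ?thesis
        using False by (auto elim!: eventually_mono)
    qed
    then have ev: "\<forall>\<^sub>F n in sequentially. indicator (cut_range r R') (norm z) * corr E E z * ennreal (rker (\<sigma> n) z) =
        ennreal (rker (\<sigma> n) z) * indicator (cut_range r (R n)) (norm z) * corr E E z"
      by eventually_elim (auto simp: cut_range_def mult.commute split: split_indicator)
    have "corr E E z < top"
      using corr_le[of E E z] fin by (auto intro: order.strict_trans1)
    then have "indicator (cut_range r R') (norm z) * corr E E z < top"
      by (auto split: split_indicator)
    then have "(\<lambda>n. indicator (cut_range r R') (norm z) * corr E E z * ennreal (rker (\<sigma> n) z))
      \<longlonglongrightarrow> indicator (cut_range r R') (norm z) * corr E E z * ennreal (rker \<sigma>' z)"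
      by (intro ennreal_tendsto_cmult tendsto_ennrealI rker_tendsto lim)
    from Lim_transform_eventually[OF this ev]
    show "(\<lambda>n. ennreal (rker (\<sigma> n) z) * indicator (cut_range r (R n)) (norm z) * corr E E z)
      \<longlonglongrightarrow> ennreal (rker \<sigma>' z) * indicator (cut_range r R') (norm z) * corr E E z"
      by (simp add: mult.commute mult.left_commute)
  qed
qed measurable

text \<open>First the set is changed from \<open>F n\<close> to \<open>E\<close> at fixed exponent
  and radius, at a cost proportional to the symmetric difference and uniform in these parameters;
  then the parameters move with \<open>E\<close> fixed.\<close>

lemma far_part_tendsto:
  fixes E :: "'a::euclidean_space set"
  assumes [measurable]: "E \<in> sets borel" "\<And>n. F n \<in> sets borel"
    and fin: "emeasure lborel E < \<infinity>" "\<And>n. emeasure lborel (F n) < \<infinity>"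
    and conv: "(\<lambda>n. measure lborel (sym_diff (F n) E)) \<longlonglongrightarrow> 0"
    and r: "0 < r" "r < 1" and s: "\<And>n. - real DIM('a) < \<sigma> n" "\<And>n. \<sigma> n < 1"
    and lim: "\<sigma> \<longlonglongrightarrow> \<sigma>'" "R \<longlonglongrightarrow> R'" and s': "- real DIM('a) < \<sigma>'" "\<sigma>' < 1"
  shows "(\<lambda>n. far_part (\<sigma> n) r (R n) (F n)) \<longlonglongrightarrow> far_part \<sigma>' r R' E"
proof -
  let ?m = "measure lborel" and ?\<delta> = "\<lambda>n. measure lborel (sym_diff (F n) E)"
  let ?C = "1 / r powr (real DIM('a) + 1)"
  let ?J = "\<lambda>n A. enn2real (interaction (\<sigma> n) (cut_range r (R n)) A A)"
  have fm [simp, intro]: "E \<in> fmeasurable lborel" "F n \<in> fmeasurable lborel" for n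
    using fin by (auto simp: fmeasurable_def)
  have diff: "?m (F n - E) \<le> ?\<delta> n" "?m (E - F n) \<le> ?\<delta> n" for n
    by (auto intro!: measure_mono_fmeasurable fmeasurable.Un fmeasurable.Diff)
  have "\<bar>?m (F n) - ?m E\<bar> \<le> ?\<delta> n" for n
  proof -
    have "?m (F n) \<le> ?m (E \<union> (F n - E))" "?m E \<le> ?m (F n \<union> (E - F n))"
      by (auto intro!: measure_mono_fmeasurable fmeasurable.Un fmeasurable.Diff)
    moreover have "?m (E \<union> (F n - E)) \<le> ?m E + ?m (F n - E)" "?m (F n \<union> (E - F n)) \<le> ?m (F n) + ?m (E - F n)"
      by (intro measure_Un_le; measurable)+
    ultimately show ?thesis
      using diff[of n] by linarith
  qed
  then have mF: "(\<lambda>n. ?m (F n)) \<longlonglongrightarrow> ?m E"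
    by (intro LIM_zero_cancel[OF Lim_null_comparison[OF _ conv]]) auto
  have "\<bar>?J n (F n) - ?J n E\<bar> \<le> ?C * (?\<delta> n * (?m (F n) + ?m E))" for n
  proof -
    have S: "cut_range r (R n) \<subseteq> {r..}"
      by (auto simp: cut_range_def)
    have C: "?C * (d * (?m (F n) + ?m E)) \<le> ?C * (?\<delta> n * (?m (F n) + ?m E))" if "d \<le> ?\<delta> n" for d
      using that by (intro mult_left_mono mult_right_mono) auto
    have comm: "?m E + ?m (F n) = ?m (F n) + ?m E"
      by simp
    have "?J n (F n) \<le> ?J n E + ?C * (?m (F n - E) * (?m (F n) + ?m E))"
      "?J n E \<le> ?J n (F n) + ?C * (?m (E - F n) * (?m (F n) + ?m E))"
      using interaction_diff_le[OF assms(2)[of n] assms(1) cut_range_measurable r s S fin(2,1)]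
        interaction_diff_le[OF assms(1) assms(2)[of n] cut_range_measurable r s S fin(1,2), unfolded comm]
      by auto
    moreover have "\<bar>a - b\<bar> \<le> z" if "a \<le> b + x" "b \<le> a + y" "x \<le> z" "y \<le> z" for a b x y z :: real
      using that by linarith
    ultimately show ?thesis
      using C[OF diff(1)] C[OF diff(2)] by blast
  qed
  then have "\<forall>\<^sub>F n in sequentially. norm (?J n (F n) - ?J n E) \<le> ?C * (?\<delta> n * (?m (F n) + ?m E))"
    unfolding real_norm_def by (rule always_eventually[OF allI])
  moreover have "(\<lambda>n. ?C * (?\<delta> n * (?m (F n) + ?m E))) \<longlonglongrightarrow> ?C * (0 * (?m E + ?m E))"
    by (intro tendsto_intros conv mF)
  then have "(\<lambda>n. ?C * (?\<delta> n * (?m (F n) + ?m E))) \<longlonglongrightarrow> 0"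
    unfolding mult_zero_left mult_zero_right .
  ultimately have "(\<lambda>n. ?J n (F n) - ?J n E) \<longlonglongrightarrow> 0"
    by (rule Lim_null_comparison)
  moreover have "(\<lambda>n. ?J n E) \<longlonglongrightarrow> enn2real (interaction \<sigma>' (cut_range r R') E E)"
  proof (rule tendsto_enn2real)
    have "interaction \<sigma>' (cut_range r R') E E < \<infinity>"
      by (rule interaction_far_finite[OF assms(1,1) cut_range_measurable r s' _ fin(1,1)])
         (auto simp: cut_range_def)
    then show "(\<lambda>n. interaction (\<sigma> n) (cut_range r (R n)) E E) \<longlonglongrightarrow>
        ennreal (enn2real (interaction \<sigma>' (cut_range r R') E E))"
      using interaction_tendsto[OF assms(1) fin(1) r s lim] by simp
  qed simp
  ultimately have "(\<lambda>n. ?J n (F n)) \<longlonglongrightarrow> enn2real (interaction \<sigma>' (cut_range r R') E E)"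
    by (rule Lim_transform[rotated])
  moreover have "(\<lambda>n. gammaR TYPE('a) (\<sigma> n) r) \<longlonglongrightarrow> gammaR TYPE('a) \<sigma>' r"
    by (rule isCont_tendsto_compose[OF isCont_gammaR[OF r(1)] lim(1)])
  ultimately show ?thesis
    unfolding far_part_def using mF by (intro tendsto_diff tendsto_mult tendsto_minus)
qed

text \<open>Lowering the cut-off from \<open>r\<close> to \<open>\<epsilon>\<close> absorbs the
  annular part of the near term into the far part, by the same trade as in
  \<open>Hhat_decomp\<close>. Hence far parts increase as the cut-off shrinks.\<close>

lemma far_part_refine:
  fixes E :: "'a::euclidean_space set"
  assumes [measurable]: "E \<in> sets borel" and fin: "emeasure lborel E < \<infinity>"
    and r: "0 < \<epsilon>" "\<epsilon> \<le> r" "r < 1" "ereal r < R" and s: "- real DIM('a) < \<sigma>" "\<sigma> < 1"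
  shows "enn2ereal (interaction \<sigma> {\<epsilon>..<r} E (- E)) + ereal (far_part \<sigma> r R E) = ereal (far_part \<sigma> \<epsilon> R E)"
proof -
  let ?\<gamma> = "gammaR TYPE('a) \<sigma>"
  obtain a b where ab: "interaction \<sigma> {\<epsilon>..<r} E E = ennreal a" "interaction \<sigma> {\<epsilon>..<r} E (- E) = ennreal b"
    "0 \<le> a" "0 \<le> b" "a + b = measure lborel E * (?\<gamma> r - ?\<gamma> \<epsilon>)"
    using interaction_splitE[OF assms(1) _ assms(2) nn_integral_rker_annulus, of \<epsilon> r] r
    by (metis atLeastLessThan_borel diff_ge_0_iff_ge gammaR_mono)
  have "interaction \<sigma> (cut_range r R) E E < top"
    using interaction_far_finite[OF assms(1) assms(1) _ _ _ s _ fin fin, of "cut_range r R" r] r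
    by (auto simp: cut_range_def[of r])
  then obtain c where c: "interaction \<sigma> (cut_range r R) E E = ennreal c" "0 \<le> c"
    by (metis ennreal_cases less_irrefl)
  have "cut_range \<epsilon> R = {\<epsilon>..<r} \<union> cut_range r R"
    using r by (auto simp: cut_range_def) (metis ereal_less(2) less_ereal.simps(1) order.strict_trans)
  then have "interaction \<sigma> (cut_range \<epsilon> R) E E = interaction \<sigma> {\<epsilon>..<r} E E + interaction \<sigma> (cut_range r R) E E"
    using interaction_Un[of E E "{\<epsilon>..<r}" "cut_range r R"]
    by (simp add: cut_range_def[of r] disjoint_iff)
  then have "interaction \<sigma> (cut_range \<epsilon> R) E E = ennreal (a + c)"
    using ab c by simp
  then show ?thesis
    using ab c by (simp add: far_part_def algebra_simps flip: ennreal_plus)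
qed

section \<open>Passage to the limit in the liminf inequality\<close>

lemma enn2ereal_SUP_le:
  assumes "\<And>n::nat. enn2ereal (f n) \<le> c"
  shows "enn2ereal (SUP n. f n) \<le> c"
proof -
  \<comment> \<open>The bound at index 0 makes \<open>c\<close> nonnegative, so that it comes from
    an \<open>ennreal\<close>.\<close>
  have "0 \<le> c"
    using assms[of 0] by (rule order.trans[rotated]) simp
  then have c: "enn2ereal (e2ennreal c) = c"
    by (rule enn2ereal_e2ennreal)
  have "(SUP n. f n) \<le> e2ennreal c"
    using assms c by (intro SUP_least) (simp add: less_eq_ennreal.rep_eq)
  then show ?thesis
    using c by (simp add: less_eq_ennreal.rep_eq)
qed

lemma radius_below:
  assumes "0 < (R::ereal)"
  obtains r where "0 < r" "r < 1" "ereal r < R"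
proof -
  obtain q where "0 < ereal q" "ereal q < min 1 R"
    using assms ereal_dense2[of 0 "min 1 R"] by auto
  then show thesis
    by (intro that[of q]) auto
qed

text \<open>At a fixed cut-off the nonnegative near parts of the \<open>F n\<close> are dropped and
  the far parts converge. Only afterwards is the cut-off sent to 0, for the limit set
  \<open>E\<close> alone.\<close>

lemma liminf_Hhat_borel:
  fixes E :: "'a::euclidean_space set"
  assumes [measurable]: "E \<in> sets borel" "\<And>n. F n \<in> sets borel"
    and fin: "emeasure lborel E < \<infinity>" "\<And>n. emeasure lborel (F n) < \<infinity>"
    and conv: "(\<lambda>n. measure lborel (sym_diff (F n) E)) \<longlonglongrightarrow> 0"
    and R: "0 < R'" and s: "\<And>n. - real DIM('a) < \<sigma> n" "\<And>n. \<sigma> n < 1"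
    and lim: "\<sigma> \<longlonglongrightarrow> \<sigma>'" "R \<longlonglongrightarrow> R'" and s': "- real DIM('a) < \<sigma>'" "\<sigma>' < 1"
  shows "Hhat \<sigma>' R' E \<le> liminf (\<lambda>n. Hhat (\<sigma> n) (R n) (F n))"
proof -
  let ?L = "liminf (\<lambda>n. Hhat (\<sigma> n) (R n) (F n))"
  obtain r where r: "0 < r" "r < 1" "ereal r < R'"
    by (rule radius_below[OF R])
  have far_le: "ereal (far_part \<sigma>' \<epsilon> R' E) \<le> ?L" if \<epsilon>: "0 < \<epsilon>" "\<epsilon> \<le> r" for \<epsilon>
  proof -
    have lt: "ereal \<epsilon> < R'" "\<epsilon> < 1"
      using r \<epsilon> by (auto intro: le_less_trans[of _ "ereal r"])
    have "(\<lambda>n. ereal (far_part (\<sigma> n) \<epsilon> (R n) (F n))) \<longlonglongrightarrow> ereal (far_part \<sigma>' \<epsilon> R' E)"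
      using assms \<epsilon> lt by (intro tendsto_ereal far_part_tendsto) auto
    then have "ereal (far_part \<sigma>' \<epsilon> R' E) = liminf (\<lambda>n. ereal (far_part (\<sigma> n) \<epsilon> (R n) (F n)))"
      by (intro lim_imp_Liminf[symmetric]) auto
    also have "\<dots> \<le> ?L"
    proof (rule Liminf_mono)
      show "\<forall>\<^sub>F n in sequentially. ereal (far_part (\<sigma> n) \<epsilon> (R n) (F n)) \<le> Hhat (\<sigma> n) (R n) (F n)"
        using order_tendstoD(1)[OF lim(2) lt(1)]
      proof eventually_elim
        case (elim n)
        have "0 + ereal (far_part (\<sigma> n) \<epsilon> (R n) (F n)) \<le>
          enn2ereal (interaction (\<sigma> n) {..<\<epsilon>} (F n) (- F n)) + ereal (far_part (\<sigma> n) \<epsilon> (R n) (F n))"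
          by (intro add_right_mono) simp
        then show ?case
          using elim \<epsilon> lt s fin by (simp add: Hhat_decomp[of _ \<epsilon>])
      qed
    qed
    finally show ?thesis .
  qed
  \<comment> \<open>Subtracting the finite far part at \<open>r\<close> turns the bound at the
    smaller cut-off into a bound on the annular near term of \<open>E\<close>.\<close>
  have "enn2ereal (interaction \<sigma>' {r / (real n + 1)..<r} E (- E)) \<le> ?L - ereal (far_part \<sigma>' r R' E)" for n
  proof -
    let ?\<epsilon> = "r / (real n + 1)"
    have \<epsilon>: "0 < ?\<epsilon>" "?\<epsilon> \<le> r"
      using r by (auto simp: field_simps)
    show ?thesis
      using far_le[OF \<epsilon>] far_part_refine[OF assms(1) fin(1) \<epsilon> r(2,3) s']
      by (simp add: ereal_le_minus)
  qed
  moreover have "interaction \<sigma>' {..<r} E (- E) = (SUP n. interaction \<sigma>' {r / (real n + 1)..<r} E (- E))"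
    unfolding interaction_def using r by (intro nn_integral_rker_inside_SUP) auto
  ultimately have "enn2ereal (interaction \<sigma>' {..<r} E (- E)) \<le> ?L - ereal (far_part \<sigma>' r R' E)"
    by (simp add: enn2ereal_SUP_le)
  then show ?thesis
    using Hhat_decomp[OF assms(1) fin(1) r s'] by (simp add: ereal_le_minus)
qed

section \<open>Mollification and level sets\<close>

lemma nn_integral_lborel_reflect:
  fixes c :: "'a::euclidean_space"
  assumes [measurable]: "f \<in> borel_measurable borel"
  shows "(\<integral>\<^sup>+x. f (c - x) \<partial>lborel) = (\<integral>\<^sup>+x. f x \<partial>lborel)"
proof -
  have "(\<integral>\<^sup>+x. f x \<partial>lborel) =
      (\<integral>\<^sup>+x. f x \<partial>density (distr lborel borel (\<lambda>x. c + (- 1) *\<^sub>R x)) (\<lambda>_. ennreal (\<bar>- 1\<bar> ^ DIM('a))))"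
    by (subst lborel_affine[of "- 1" c]) simp_all
  also have "\<dots> = (\<integral>\<^sup>+x. f (c - x) \<partial>lborel)"
    by (simp add: nn_integral_density nn_integral_distr)
  finally show ?thesis ..
qed

definition convol :: "('a::euclidean_space \<Rightarrow> ennreal) \<Rightarrow> ('a \<Rightarrow> ennreal) \<Rightarrow> 'a \<Rightarrow> ennreal" where
  "convol f g x = (\<integral>\<^sup>+y. f (x - y) * g y \<partial>lborel)"

lemma convol_measurable [measurable]:
  assumes [measurable]: "f \<in> borel_measurable borel" "g \<in> borel_measurable borel"
  shows "convol f g \<in> borel_measurable borel"
  unfolding convol_def by measurable

lemma convol_commute:
  assumes [measurable]: "f \<in> borel_measurable borel" "g \<in> borel_measurable borel"
  shows "convol f g x = convol g f x"
  unfolding convol_def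
  by (subst nn_integral_lborel_reflect[symmetric, of _ x]) (simp_all add: mult.commute)

text \<open>Subtraction in \<open>ennreal\<close> truncates at 0, so the integrand is the positive
  part of \<open>f x - f (x + z)\<close>.\<close>

definition drop_integral :: "('a::euclidean_space \<Rightarrow> ennreal) \<Rightarrow> 'a \<Rightarrow> ennreal" where
  "drop_integral f z = (\<integral>\<^sup>+x. f x - f (x + z) \<partial>lborel)"

lemma drop_integral_measurable [measurable]:
  assumes [measurable]: "f \<in> borel_measurable borel"
  shows "drop_integral f \<in> borel_measurable borel"
  unfolding drop_integral_def by measurable

lemma drop_integral_indicator: "drop_integral (indicator E) z = corr E (- E) z"
  unfolding drop_integral_def corr_def
  by (intro nn_integral_cong) (auto split: split_indicator)

lemma ennreal_le_add_diff: "(a::ennreal) \<le> b + (a - b)"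
proof (cases "a \<le> b")
  case True
  then show ?thesis
    by (simp add: add_increasing2)
next
  case False
  then have "b \<le> a"
    by simp
  from diff_add_cancel_ennreal[OF this] show ?thesis
    by (metis add.commute order_refl)
qed

text \<open>The convolution averages translates of \<open>f\<close> with weight \<open>g\<close>,
  and the positive part of an average is at most the average of the positive parts. As
  \<open>f\<close> and \<open>g\<close> are arbitrary, a mollified set can be estimated through the
  set or through the ball.\<close>

lemma drop_integral_convol_le:
  fixes f g :: "'a::euclidean_space \<Rightarrow> ennreal"
  assumes [measurable]: "f \<in> borel_measurable borel" "g \<in> borel_measurable borel"
    and fin: "\<And>x. convol f g x < \<infinity>"
  shows "drop_integral (convol f g) z \<le> (\<integral>\<^sup>+y. g y \<partial>lborel) * drop_integral f z"
proof -
  have "convol f g x - convol f g (x + z) \<le> (\<integral>\<^sup>+y. (f (x - y) - f (x - y + z)) * g y \<partial>lborel)" for x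
  proof -
    have "convol f g x \<le> (\<integral>\<^sup>+y. f (x + z - y) * g y + (f (x - y) - f (x - y + z)) * g y \<partial>lborel)"
      unfolding convol_def
    proof (intro nn_integral_mono)
      fix y
      have "f (x - y) * g y \<le> (f (x - y + z) + (f (x - y) - f (x - y + z))) * g y"
        by (intro mult_right_mono ennreal_le_add_diff) simp
      then show "f (x - y) * g y \<le> f (x + z - y) * g y + (f (x - y) - f (x - y + z)) * g y"
        by (simp add: distrib_right algebra_simps)
    qed
    also have "\<dots> = convol f g (x + z) + (\<integral>\<^sup>+y. (f (x - y) - f (x - y + z)) * g y \<partial>lborel)"
      unfolding convol_def by (intro nn_integral_add) measurable
    \<comment> \<open>Finiteness of \<open>convol f g x\<close> excludes \<infinity> -
      \<infinity>.\<close>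
    finally show ?thesis
      using fin[of x] by (auto simp: ennreal_minus_le_iff add.commute)
  qed
  then have "drop_integral (convol f g) z \<le>
      (\<integral>\<^sup>+x. (\<integral>\<^sup>+y. (f (x - y) - f (x - y + z)) * g y \<partial>lborel) \<partial>lborel)"
    unfolding drop_integral_def by (intro nn_integral_mono)
  also have "\<dots> = (\<integral>\<^sup>+y. (\<integral>\<^sup>+x. (f (x - y) - f (x - y + z)) * g y \<partial>lborel) \<partial>lborel)"
    by (intro lborel_pair.Fubini') measurable
  also have "\<dots> = (\<integral>\<^sup>+y. drop_integral f z * g y \<partial>lborel)"
  proof (intro nn_integral_cong)
    fix y
    have "(\<integral>\<^sup>+x. (f (x - y) - f (x - y + z)) * g y \<partial>lborel) =
        (\<integral>\<^sup>+x. f (x + (- y)) - f (x + (- y) + z) \<partial>lborel) * g y"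
      by (subst nn_integral_multc[symmetric]) simp_all
    also have "(\<integral>\<^sup>+x. f (x + (- y)) - f (x + (- y) + z) \<partial>lborel) = drop_integral f z"
      unfolding drop_integral_def
      by (rule nn_integral_lborel_translate[of "\<lambda>x. f x - f (x + z)"]) measurable
    finally show "(\<integral>\<^sup>+x. (f (x - y) - f (x - y + z)) * g y \<partial>lborel) = drop_integral f z * g y" .
  qed
  also have "\<dots> = (\<integral>\<^sup>+y. g y \<partial>lborel) * drop_integral f z"
    by (subst nn_integral_cmult) (simp_all add: mult.commute)
  finally show ?thesis .
qed

section \<open>The coarea inequality\<close>

lemma nn_integral_layer_le:
  fixes a b :: ennreal
  assumes "a < \<infinity>"
  shows "(\<integral>\<^sup>+t. indicator {t::real. 0 \<le> t \<and> b \<le> ennreal t \<and> ennreal t < a} t \<partial>lborel) \<le> a - b"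
proof (cases "b < a")
  case True
  then obtain a' b' where ab: "a = ennreal a'" "b = ennreal b'" "0 \<le> a'" "0 \<le> b'"
    using assms by (metis ennreal_cases infinity_ennreal_def less_irrefl order.strict_trans)
  have "(\<integral>\<^sup>+t. indicator {t::real. 0 \<le> t \<and> b \<le> ennreal t \<and> ennreal t < a} t \<partial>lborel) \<le>
      (\<integral>\<^sup>+t. indicator {b'..a'} t \<partial>lborel)"
    using ab by (intro nn_integral_mono) (auto simp: ennreal_less_iff split: split_indicator)
  also have "\<dots> = a - b"
    using ab True by (simp add: ennreal_minus ennreal_less_iff)
  finally show ?thesis .
next
  case False
  then have "{t::real. 0 \<le> t \<and> b \<le> ennreal t \<and> ennreal t < a} = {}"
    by auto
  then show ?thesis
    by simp
qed

text \<open>For fixed \<open>x\<close> and \<open>z\<close>, the levels \<open>t\<close> whose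
  superlevel set contains \<open>x\<close> but not \<open>x + z\<close> fill an interval of length
  \<open>u x - u (x + z)\<close>, truncated at 0. Exchanging the integrals sums these
  lengths.\<close>

lemma coarea_le:
  fixes u :: "'a::euclidean_space \<Rightarrow> ennreal"
  assumes [measurable]: "u \<in> borel_measurable borel" "S \<in> sets borel"
    and fin: "\<And>x. u x < \<infinity>"
  shows "(\<integral>\<^sup>+t. interaction \<sigma> S {x. ennreal t < u x} (- {x. ennreal t < u x}) * indicator {0..} t \<partial>lborel) \<le>
    (\<integral>\<^sup>+z. ennreal (rker \<sigma> z) * indicator S (norm z) * drop_integral u z \<partial>lborel)"
proof -
  let ?k = "\<lambda>z::'a. ennreal (rker \<sigma> z) * indicator S (norm z)"
  let ?A = "\<lambda>t z. {x. ennreal t < u x \<and> \<not> ennreal t < u (x + z)}"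
  have corr: "corr {x. ennreal t < u x} (- {x. ennreal t < u x}) z = (\<integral>\<^sup>+x. indicator (?A t z) x \<partial>lborel)" for t z
    unfolding corr_def by (intro nn_integral_cong) (auto split: split_indicator)
  have "(\<integral>\<^sup>+t. interaction \<sigma> S {x. ennreal t < u x} (- {x. ennreal t < u x}) * indicator {0..} t \<partial>lborel) =
      (\<integral>\<^sup>+t. (\<integral>\<^sup>+z. ?k z * (\<integral>\<^sup>+x. indicator (?A t z) x \<partial>lborel) * indicator {0..} t \<partial>lborel) \<partial>lborel)"
    unfolding interaction_def corr
    by (intro nn_integral_cong nn_integral_multc[symmetric]) measurable
  also have "\<dots> = (\<integral>\<^sup>+z. (\<integral>\<^sup>+t. ?k z * (\<integral>\<^sup>+x. indicator (?A t z) x \<partial>lborel) * indicator {0..} t \<partial>lborel) \<partial>lborel)"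
    by (intro lborel_pair.Fubini') measurable
  also have "\<dots> \<le> (\<integral>\<^sup>+z. ?k z * drop_integral u z \<partial>lborel)"
  proof (intro nn_integral_mono)
    fix z
    have "(\<integral>\<^sup>+t. (\<integral>\<^sup>+x. indicator (?A t z) x \<partial>lborel) * indicator {0..} t \<partial>lborel) =
        (\<integral>\<^sup>+t. (\<integral>\<^sup>+x. indicator (?A t z) x * indicator {0..} t \<partial>lborel) \<partial>lborel)"
      by (intro nn_integral_cong nn_integral_multc[symmetric]) measurable
    also have "\<dots> = (\<integral>\<^sup>+x. (\<integral>\<^sup>+t. indicator (?A t z) x * indicator {0..} t \<partial>lborel) \<partial>lborel)"
      by (intro lborel_pair.Fubini') measurable
    also have "\<dots> \<le> drop_integral u z"
      unfolding drop_integral_def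
    proof (intro nn_integral_mono)
      fix x
      have "(\<integral>\<^sup>+t. indicator (?A t z) x * indicator {0..} t \<partial>lborel) =
          (\<integral>\<^sup>+t. indicator {t::real. 0 \<le> t \<and> u (x + z) \<le> ennreal t \<and> ennreal t < u x} t \<partial>lborel)"
        by (intro nn_integral_cong) (auto split: split_indicator)
      also have "\<dots> \<le> u x - u (x + z)"
        by (rule nn_integral_layer_le[OF fin])
      finally show "(\<integral>\<^sup>+t. indicator (?A t z) x * indicator {0..} t \<partial>lborel) \<le> u x - u (x + z)" .
    qed
    finally have le: "(\<integral>\<^sup>+t. (\<integral>\<^sup>+x. indicator (?A t z) x \<partial>lborel) * indicator {0..} t \<partial>lborel) \<le> drop_integral u z" .
    have "(\<integral>\<^sup>+t. ?k z * (\<integral>\<^sup>+x. indicator (?A t z) x \<partial>lborel) * indicator {0..} t \<partial>lborel) =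
        ?k z * (\<integral>\<^sup>+t. (\<integral>\<^sup>+x. indicator (?A t z) x \<partial>lborel) * indicator {0..} t \<partial>lborel)"
      by (subst nn_integral_cmult[symmetric]) (simp_all add: mult.assoc)
    also have "\<dots> \<le> ?k z * drop_integral u z"
      by (intro mult_left_mono le) simp
    finally show "(\<integral>\<^sup>+t. ?k z * (\<integral>\<^sup>+x. indicator (?A t z) x \<partial>lborel) * indicator {0..} t \<partial>lborel) \<le>
        ?k z * drop_integral u z" .
  qed
  finally show ?thesis .
qed

section \<open>Effect of small translations\<close>

text \<open>Points that leave the ball lie in a shell of width \<open>norm z\<close>, whose volume
  is at most linear in \<open>norm z\<close> by Bernoulli's inequality. Beyond
  \<open>\<epsilon>\<close> the volume of the whole ball is already below the bound.\<close>

lemma corr_ball_le: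
  fixes z :: "'a::euclidean_space"
  assumes "0 < \<epsilon>"
  shows "corr (ball 0 \<epsilon>) (- ball 0 \<epsilon>) z \<le>
    ennreal (unit_ball_vol DIM('a) * (real DIM('a) * \<epsilon> ^ (DIM('a) - 1) * norm z))"
proof -
  let ?d = "DIM('a)" and ?w = "unit_ball_vol DIM('a)" and ?h = "norm z"
  have pow: "\<epsilon> ^ ?d = \<epsilon> ^ (?d - 1) * \<epsilon>"
    by (metis DIM_positive power_minus_mult)
  show ?thesis
  proof (cases "?h \<le> \<epsilon>")
    case True
    have bern: "\<epsilon> ^ ?d - (\<epsilon> - ?h) ^ ?d \<le> real ?d * \<epsilon> ^ (?d - 1) * ?h"
    proof -
      have "1 + real ?d * (- ?h / \<epsilon>) \<le> (1 + (- ?h / \<epsilon>)) ^ ?d"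
        using assms True by (intro Bernoulli_inequality) (simp add: field_simps)
      then have "\<epsilon> ^ ?d * (1 + real ?d * (- ?h / \<epsilon>)) \<le> \<epsilon> ^ ?d * (1 + (- ?h / \<epsilon>)) ^ ?d"
        using assms by (intro mult_left_mono) auto
      also have "\<dots> = (\<epsilon> - ?h) ^ ?d"
        using assms by (simp add: power_mult_distrib[symmetric] field_simps)
      also have "\<epsilon> ^ ?d * (1 + real ?d * (- ?h / \<epsilon>)) = \<epsilon> ^ ?d - real ?d * \<epsilon> ^ (?d - 1) * ?h"
        using assms unfolding pow by (simp add: field_simps)
      finally show ?thesis
        by linarith
    qed
    have "corr (ball 0 \<epsilon>) (- ball 0 \<epsilon>) z = emeasure lborel {x \<in> ball 0 \<epsilon>. x + z \<in> - ball (0::'a) \<epsilon>}"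
      by (rule corr_eq_emeasure) measurable
    also have "\<dots> \<le> emeasure lborel (ball 0 \<epsilon> - ball (0::'a) (\<epsilon> - ?h))"
    proof (intro emeasure_mono)
      show "{x \<in> ball 0 \<epsilon>. x + z \<in> - ball (0::'a) \<epsilon>} \<subseteq> ball 0 \<epsilon> - ball 0 (\<epsilon> - ?h)"
      proof
        fix x assume "x \<in> {x \<in> ball 0 \<epsilon>. x + z \<in> - ball (0::'a) \<epsilon>}"
        then have "norm x < \<epsilon>" "\<epsilon> \<le> norm (x + z)"
          by auto
        then show "x \<in> ball 0 \<epsilon> - ball 0 (\<epsilon> - ?h)"
          using norm_triangle_ineq[of x z] by simp
      qed
    qed measurable
    also have "\<dots> = emeasure lborel (ball (0::'a) \<epsilon>) - emeasure lborel (ball (0::'a) (\<epsilon> - ?h))"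
    proof (rule emeasure_Diff)
      show "ball (0::'a) (\<epsilon> - ?h) \<subseteq> ball 0 \<epsilon>"
        by (intro subset_ball) simp
    qed (use True in \<open>simp_all add: emeasure_ball\<close>)
    also have "\<dots> = ennreal (?w * (\<epsilon> ^ ?d - (\<epsilon> - ?h) ^ ?d))"
      using assms True by (simp add: emeasure_ball ennreal_minus algebra_simps)
    also have "\<dots> \<le> ennreal (?w * (real ?d * \<epsilon> ^ (?d - 1) * ?h))"
      using bern by (intro ennreal_leI mult_left_mono) auto
    finally show ?thesis .
  next
    case False
    have "corr (ball 0 \<epsilon>) (- ball 0 \<epsilon>) z \<le> emeasure lborel (ball (0::'a) \<epsilon>)"
      by (intro corr_le) measurable
    also have "\<dots> = ennreal (?w * \<epsilon> ^ ?d)"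
      using assms by (simp add: emeasure_ball)
    also have "\<dots> \<le> ennreal (?w * (real ?d * \<epsilon> ^ (?d - 1) * ?h))"
    proof (intro ennreal_leI mult_left_mono)
      have "\<epsilon> ^ ?d \<le> \<epsilon> ^ (?d - 1) * ?h"
        unfolding pow using assms False by (intro mult_left_mono) auto
      also have "\<dots> = 1 * (\<epsilon> ^ (?d - 1) * ?h)"
        by simp
      also have "\<dots> \<le> real ?d * (\<epsilon> ^ (?d - 1) * ?h)"
        using assms DIM_ge_Suc0[where 'a = 'a] by (intro mult_right_mono mult_nonneg_nonneg) auto
      finally show "\<epsilon> ^ ?d \<le> real ?d * \<epsilon> ^ (?d - 1) * ?h"
        by (simp only: mult.assoc)
    qed simp
    finally show ?thesis .
  qed
qed

text \<open>A linear bound gains one order: \<sigma> < 1 becomes \<sigma> - 1 < 0, where the kernel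
  is integrable at the origin.\<close>

lemma rker_times_norm:
  fixes z :: "'a::euclidean_space"
  shows "rker \<sigma> z * norm z = rker (\<sigma> - 1) z"
proof (cases "z = 0")
  case False
  have "norm z powr (real DIM('a) + \<sigma>) = norm z powr (real DIM('a) + (\<sigma> - 1)) * norm z"
    using powr_add[of "norm z" "real DIM('a) + (\<sigma> - 1)" 1] by simp
  with False show ?thesis
    unfolding rker_def by simp
qed simp

lemma corr_swap:
  fixes A B :: "'a::euclidean_space set"
  assumes [measurable]: "A \<in> sets borel" "B \<in> sets borel"
  shows "corr A B z = corr B A (- z)"
proof -
  have "corr B A (- z) = (\<integral>\<^sup>+x. indicator B (x + z) * indicator A (x + z + - z) \<partial>lborel)"
    unfolding corr_def
    by (rule nn_integral_lborel_translate[symmetric]) measurable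
  then show ?thesis
    by (simp add: corr_def mult.commute)
qed

text \<open>Continuity of translation: up to small measure, \<open>E\<close> lies between a compact
  \<open>K\<close> and an open \<open>T\<close>, and small shifts of \<open>K\<close> stay in
  \<open>T\<close>.\<close>

lemma corr_compl_small:
  fixes E :: "'a::euclidean_space set"
  assumes [measurable]: "E \<in> sets borel" and fin: "emeasure lborel E < \<infinity>" and "0 < \<kappa>"
  obtains \<epsilon> where "0 < \<epsilon>" "\<And>z. norm z < \<epsilon> \<Longrightarrow> corr E (- E) z \<le> ennreal \<kappa>"
proof -
  have E: "E \<in> sets lebesgue"
    by simp
  have pos: "0 < \<kappa> / 3"
    using \<open>0 < \<kappa>\<close> by simp
  obtain K0 where K0: "closed K0" "K0 \<subseteq> E" "E - K0 \<in> lmeasurable"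
      "emeasure lebesgue (E - K0) < ennreal (\<kappa> / 3)"
    by (rule sets_lebesgue_inner_closed[OF E pos])
  obtain T where T: "open T" "E \<subseteq> T" "T - E \<in> lmeasurable"
      "emeasure lebesgue (T - E) < ennreal (\<kappa> / 3)"
    by (rule sets_lebesgue_outer_open[OF E pos])
  have [measurable]: "K0 \<in> sets borel" "T \<in> sets borel" "cball 0 (real n) \<in> sets borel" for n
    using K0(1) T(1) by (auto intro: borel_closed)
  have K0': "emeasure lborel (E - K0) < ennreal (\<kappa> / 3)" and T': "emeasure lborel (T - E) < ennreal (\<kappa> / 3)"
    using K0(4) T(4) by simp_all
  have finK: "emeasure lborel (K0 - cball 0 (real n)) \<noteq> \<infinity>" for n
  proof -
    have "emeasure lborel (K0 - cball 0 (real n)) \<le> emeasure lborel E"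
      using K0(2) by (intro emeasure_mono) auto
    with fin show ?thesis
      by (metis leD)
  qed
  \<comment> \<open>Cutting the closed set \<open>K0\<close> by a large ball makes it compact and
    loses little measure.\<close>
  have "(\<lambda>n. emeasure lborel (K0 - cball 0 (real n))) \<longlonglongrightarrow> emeasure lborel (\<Inter>n. K0 - cball 0 (real n))"
    using finK by (intro Lim_emeasure_decseq) (auto simp: decseq_def)
  moreover have "(\<Inter>n. K0 - cball 0 (real n)) = {}"
    by (auto simp: real_arch_simple)
  ultimately have "(\<lambda>n. emeasure lborel (K0 - cball 0 (real n))) \<longlonglongrightarrow> 0"
    by (simp only: emeasure_empty)
  then have "\<forall>\<^sub>F n in sequentially. emeasure lborel (K0 - cball 0 (real n)) < ennreal (\<kappa> / 3)"
    using \<open>0 < \<kappa>\<close> by (intro order_tendstoD) auto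
  then obtain n where n: "emeasure lborel (K0 - cball 0 (real n)) < ennreal (\<kappa> / 3)"
    by (auto simp: eventually_sequentially)
  define K where "K = K0 \<inter> cball 0 (real n)"
  have "compact K"
    unfolding K_def by (intro closed_Int_compact K0 compact_cball)
  moreover have "K \<subseteq> T"
    using K0 T by (auto simp: K_def)
  ultimately obtain \<epsilon> where \<epsilon>: "0 < \<epsilon>" "(\<Union>x\<in>K. ball x \<epsilon>) \<subseteq> T"
    by (rule compact_subset_open_imp_ball_epsilon_subset[OF _ T(1)])
  show thesis
  proof (rule that[OF \<epsilon>(1)])
    fix z :: 'a assume z: "norm z < \<epsilon>"
    have "x + z \<in> T" if "x \<in> K" for x
    proof -
      have "x + z \<in> ball x \<epsilon>"
        using z by (simp add: dist_norm)
      with that \<epsilon>(2) show ?thesis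
        by blast
    qed
    \<comment> \<open>A point of \<open>E\<close> that leaves \<open>E\<close> is outside
      \<open>K0\<close>, or in \<open>K0\<close> outside the large ball, or in \<open>K\<close> and
      then lands in \<open>T - E\<close>. Each possibility costs
      \<open>\<kappa> / 3\<close>.\<close>
    then have "indicator E x * indicator (- E) (x + z) \<le>
        indicator (E - K0) x + (indicator (K0 - cball 0 (real n)) x + indicator (T - E) (x + z) :: ennreal)" for x
      using K0(2) by (cases "x \<in> K0"; cases "x \<in> cball 0 (real n)"; cases "x \<in> E"; cases "x + z \<in> E")
        (simp_all add: K_def indicator_def)
    then have "corr E (- E) z \<le> (\<integral>\<^sup>+x. indicator (E - K0) x +
        (indicator (K0 - cball 0 (real n)) x + indicator (T - E) (x + z)) \<partial>lborel)"
      unfolding corr_def by (intro nn_integral_mono)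
    also have "\<dots> = (\<integral>\<^sup>+x. indicator (E - K0) x \<partial>lborel) +
        (\<integral>\<^sup>+x. indicator (K0 - cball 0 (real n)) x + indicator (T - E) (x + z) \<partial>lborel)"
      by (rule nn_integral_add) measurable
    also have "(\<integral>\<^sup>+x. indicator (K0 - cball 0 (real n)) x + indicator (T - E) (x + z) \<partial>lborel) =
        (\<integral>\<^sup>+x. indicator (K0 - cball 0 (real n)) x \<partial>lborel) +
        (\<integral>\<^sup>+x. indicator (T - E) (x + z) \<partial>lborel)"
      by (rule nn_integral_add) measurable
    also have "(\<integral>\<^sup>+x. indicator (T - E) (x + z) \<partial>lborel) = emeasure lborel (T - E)"
      by (subst nn_integral_lborel_translate) simp_all
    also have "(\<integral>\<^sup>+x. indicator (E - K0) x \<partial>lborel) +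
        ((\<integral>\<^sup>+x. indicator (K0 - cball 0 (real n)) x \<partial>lborel) + emeasure lborel (T - E)) \<le>
        ennreal (\<kappa> / 3) + (ennreal (\<kappa> / 3) + ennreal (\<kappa> / 3))"
      using K0' T' n by (intro add_mono) simp_all
    also have "\<dots> = ennreal \<kappa>"
      using \<open>0 < \<kappa>\<close> by (simp flip: ennreal_plus)
    finally show "corr E (- E) z \<le> ennreal \<kappa>" .
  qed
qed

section \<open>Closeness of the superlevel sets\<close>

lemma ball_measurable [measurable]: "ball (c::'a::euclidean_space) r \<in> sets borel"
  by simp

lemma nn_integral_indicator_convol:
  fixes A B C :: "'a::euclidean_space set"
  assumes [measurable]: "A \<in> sets borel" "B \<in> sets borel" "C \<in> sets borel"
  shows "(\<integral>\<^sup>+x. indicator A x * convol (indicator C) (indicator B) x \<partial>lborel) =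
    (\<integral>\<^sup>+y. corr A C (- y) * indicator B y \<partial>lborel)"
proof -
  have "(\<integral>\<^sup>+x. indicator A x * convol (indicator C) (indicator B) x \<partial>lborel) =
      (\<integral>\<^sup>+x. (\<integral>\<^sup>+y. indicator A x * indicator C (x + - y) * indicator B y \<partial>lborel) \<partial>lborel)"
    unfolding convol_def
    by (intro nn_integral_cong) (subst nn_integral_cmult[symmetric], auto simp: mult.assoc)
  also have "\<dots> = (\<integral>\<^sup>+y. (\<integral>\<^sup>+x. indicator A x * indicator C (x + - y) * indicator B y \<partial>lborel) \<partial>lborel)"
    by (intro lborel_pair.Fubini') measurable
  also have "\<dots> = (\<integral>\<^sup>+y. corr A C (- y) * indicator B y \<partial>lborel)"
    unfolding corr_def by (intro nn_integral_cong nn_integral_multc) measurable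
  finally show ?thesis .
qed

lemma ennreal_le_divideI:
  assumes "ennreal c * m \<le> ennreal q" "0 < c" "0 \<le> q"
  shows "m \<le> ennreal (q / c)"
proof (cases m)
  case (real m')
  then show ?thesis
    using assms by (simp add: ennreal_mult'[symmetric] pos_le_divide_eq mult.commute)
next
  case top
  then show ?thesis
    using assms by (simp add: ennreal_mult_top top_unique)
qed

lemma nn_integral_corr_ball_le:
  fixes A C :: "'a::euclidean_space set"
  assumes "\<And>z. norm z < \<epsilon> \<Longrightarrow> corr A C z \<le> ennreal \<kappa>"
  shows "(\<integral>\<^sup>+y. corr A C (- y) * indicator (ball 0 \<epsilon>) y \<partial>lborel) \<le> ennreal \<kappa> * emeasure lborel (ball (0::'a) \<epsilon>)"
proof -
  have "(\<integral>\<^sup>+y. corr A C (- y) * indicator (ball 0 \<epsilon>) y \<partial>lborel) \<le>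
      (\<integral>\<^sup>+y. ennreal \<kappa> * indicator (ball (0::'a) \<epsilon>) y \<partial>lborel)"
    using assms by (intro nn_integral_mono) (auto split: split_indicator)
  then show ?thesis
    by (simp add: nn_integral_cmult_indicator)
qed

text \<open>Chebyshev's inequality: a point of the level set outside \<open>E\<close> has
  \<open>u\<close> at least \<open>\<delta> * \<beta>\<close>, a point of \<open>E\<close> outside
  the level set has \<open>\<beta> - u\<close> at least that, and the integrals of these functions
  over \<open>- E\<close> and \<open>E\<close> are at most
  \<open>\<kappa> * \<beta>\<close>.\<close>

lemma level_set_close:
  fixes E :: "'a::euclidean_space set" and \<epsilon> :: real
  defines "\<beta> \<equiv> measure lborel (ball (0::'a) \<epsilon>)"
    and "u \<equiv> convol (indicator E) (indicator (ball 0 \<epsilon>))"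
  assumes [measurable]: "E \<in> sets borel"
    and small: "\<And>z. norm z < \<epsilon> \<Longrightarrow> corr E (- E) z \<le> ennreal \<kappa>"
    and pos: "0 < \<epsilon>" "0 < \<delta>" "0 \<le> \<kappa>" and t: "\<delta> * \<beta> \<le> t" "t \<le> (1 - \<delta>) * \<beta>"
  shows "emeasure lborel ({x. ennreal t < u x} - E) \<le> ennreal (\<kappa> / \<delta>)"
    and "emeasure lborel (E - {x. ennreal t < u x}) \<le> ennreal (\<kappa> / \<delta>)"
proof -
  let ?B = "ball (0::'a) \<epsilon>"
  \<comment> \<open>This is \<open>\<beta> - u\<close>, written as a convolution so that both
    estimates become instances of \<open>conclude\<close>.\<close>
  define v where "v = convol (indicator (- E)) (indicator ?B)"
  have \<beta>: "emeasure lborel ?B = ennreal \<beta>" "0 < \<beta>"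
    using pos emeasure_lborel_ball_finite[of "0::'a" \<epsilon>]
    by (simp_all add: \<beta>_def emeasure_eq_ennreal_measure)
  have [measurable]: "u \<in> borel_measurable borel" "v \<in> borel_measurable borel"
    unfolding u_def v_def by measurable
  have uv: "u x + v x = ennreal \<beta>" for x
  proof -
    have "u x + v x = (\<integral>\<^sup>+y. indicator E (x - y) * indicator ?B y + indicator (- E) (x - y) * indicator ?B y \<partial>lborel)"
      unfolding u_def v_def convol_def by (intro nn_integral_add[symmetric]) measurable
    also have "\<dots> = (\<integral>\<^sup>+y. indicator ?B y \<partial>lborel)"
      by (intro nn_integral_cong) (auto split: split_indicator)
    finally show ?thesis
      by (simp add: \<beta>)
  qed
  have conclude: "emeasure lborel A \<le> ennreal (\<kappa> / \<delta>)"
    if [measurable]: "A \<in> sets borel" "C \<in> sets borel" "D \<in> sets borel" and "A \<subseteq> C"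
      and le: "\<And>x. x \<in> A \<Longrightarrow> ennreal (\<delta> * \<beta>) \<le> convol (indicator D) (indicator ?B) x"
      and corr: "\<And>z. norm z < \<epsilon> \<Longrightarrow> corr C D z \<le> ennreal \<kappa>" for A C D
  proof -
    have "ennreal (\<delta> * \<beta>) * emeasure lborel A = (\<integral>\<^sup>+x. ennreal (\<delta> * \<beta>) * indicator A x \<partial>lborel)"
      by (simp add: nn_integral_cmult_indicator)
    also have "\<dots> \<le> (\<integral>\<^sup>+x. indicator C x * convol (indicator D) (indicator ?B) x \<partial>lborel)"
      using le \<open>A \<subseteq> C\<close> by (intro nn_integral_mono) (auto split: split_indicator)
    also have "\<dots> = (\<integral>\<^sup>+y. corr C D (- y) * indicator ?B y \<partial>lborel)"
      by (rule nn_integral_indicator_convol) measurable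
    also have "\<dots> \<le> ennreal \<kappa> * ennreal \<beta>"
      using nn_integral_corr_ball_le[where \<epsilon> = \<epsilon> and A = C and C = D, OF corr] by (simp add: \<beta>)
    finally have "emeasure lborel A \<le> ennreal ((\<kappa> * \<beta>) / (\<delta> * \<beta>))"
      using \<beta> pos by (intro ennreal_le_divideI) (auto simp: ennreal_mult)
    then show ?thesis
      using \<beta> by simp
  qed
  \<comment> \<open>The ball is symmetric, so replacing \<open>z\<close> by \<open>- z\<close>
    exchanges the roles of \<open>E\<close> and its complement.\<close>
  have small': "corr (- E) E z \<le> ennreal \<kappa>" if "norm z < \<epsilon>" for z
    using small[of "- z"] that corr_swap[of "- E" E z] by simp
  show "emeasure lborel ({x. ennreal t < u x} - E) \<le> ennreal (\<kappa> / \<delta>)"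
  proof (rule conclude[where C = "- E" and D = E])
    fix x assume "x \<in> {x. ennreal t < u x} - E"
    then show "ennreal (\<delta> * \<beta>) \<le> convol (indicator E) (indicator ?B) x"
      using t ennreal_leI[OF t(1)] unfolding u_def by auto
  qed (use small' in auto)
  show "emeasure lborel (E - {x. ennreal t < u x}) \<le> ennreal (\<kappa> / \<delta>)"
  proof (rule conclude[where C = E and D = "- E"])
    fix x assume "x \<in> E - {x. ennreal t < u x}"
    then have le: "u x \<le> ennreal t"
      by auto
    obtain a b where ab: "u x = ennreal a" "v x = ennreal b" "0 \<le> a" "0 \<le> b" "a + b = \<beta>"
      using uv[of x] \<beta> by (elim ennreal_add_eqE) auto
    have "0 \<le> t"
      using t(1) pos \<beta> by (meson less_le_trans less_imp_le mult_pos_pos)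
    then have "a \<le> t"
      using le ab by simp
    then have "\<delta> * \<beta> \<le> b"
      using ab t by (simp add: algebra_simps)
    then show "ennreal (\<delta> * \<beta>) \<le> convol (indicator (- E)) (indicator ?B) x"
      using ab unfolding v_def by (simp add: ennreal_leI)
  qed (use small in auto)
qed

text \<open>Commuting the convolution yields two bounds: the one through \<open>E\<close> compares
  near parts, the one through the ball is linear in \<open>norm z\<close> and provides a
  majorant.\<close>

lemma drop_integral_mollified:
  fixes E :: "'a::euclidean_space set" and \<epsilon> :: real
  defines "u \<equiv> convol (indicator E) (indicator (ball 0 \<epsilon>))"
  assumes [measurable]: "E \<in> sets borel" and fin: "emeasure lborel E < \<infinity>" and "0 < \<epsilon>"
  shows "\<And>x. u x < \<infinity>"
    and "drop_integral u z \<le> emeasure lborel (ball (0::'a) \<epsilon>) * corr E (- E) z"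
    and "drop_integral u z \<le> emeasure lborel E *
      ennreal (unit_ball_vol DIM('a) * (real DIM('a) * \<epsilon> ^ (DIM('a) - 1) * norm z))"
proof -
  let ?B = "ball (0::'a) \<epsilon>"
  show u: "u x < \<infinity>" for x
  proof -
    have "u x \<le> (\<integral>\<^sup>+y. indicator ?B y \<partial>lborel)"
      unfolding u_def convol_def by (intro nn_integral_mono) (auto split: split_indicator)
    also have "\<dots> < \<infinity>"
      using emeasure_lborel_ball_finite[of "0::'a" \<epsilon>] by simp
    finally show ?thesis .
  qed
  have u': "u = convol (indicator ?B) (indicator E)"
    unfolding u_def by (intro ext convol_commute) measurable
  show "drop_integral u z \<le> emeasure lborel ?B * corr E (- E) z"
    using drop_integral_convol_le[of "indicator E" "indicator ?B" z] u
    by (simp add: u_def drop_integral_indicator)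
  have "drop_integral u z \<le> emeasure lborel E * corr ?B (- ?B) z"
    using drop_integral_convol_le[of "indicator ?B" "indicator E" z] u
    by (simp add: u' drop_integral_indicator)
  also have "\<dots> \<le> emeasure lborel E *
      ennreal (unit_ball_vol DIM('a) * (real DIM('a) * \<epsilon> ^ (DIM('a) - 1) * norm z))"
    by (intro mult_left_mono corr_ball_le \<open>0 < \<epsilon>\<close>) simp
  finally show "drop_integral u z \<le> emeasure lborel E *
      ennreal (unit_ball_vol DIM('a) * (real DIM('a) * \<epsilon> ^ (DIM('a) - 1) * norm z))" .
qed

text \<open>Dominated convergence: with \<open>s\<close> between \<open>\<sigma>'\<close> and 1, the
  linear bound on \<open>f\<close> turns the kernel of order \<open>s\<close> into one of order
  \<open>s - 1 < 0\<close>, which is integrable at the origin.\<close>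

lemma weighted_drop_tendsto:
  fixes f :: "'a::euclidean_space \<Rightarrow> ennreal"
  assumes [measurable]: "f \<in> borel_measurable borel"
    and bound: "\<And>z. f z \<le> ennreal (C * norm z)" "0 \<le> C"
    and r: "0 < r" "r < 1" and lim: "\<sigma> \<longlonglongrightarrow> \<sigma>'" "\<sigma>' < 1"
  shows "(\<lambda>n. \<integral>\<^sup>+z. ennreal (rker (\<sigma> n) z) * indicator {..<r} (norm z) * f z \<partial>lborel)
    \<longlonglongrightarrow> (\<integral>\<^sup>+z. ennreal (rker \<sigma>' z) * indicator {..<r} (norm z) * f z \<partial>lborel)"
proof -
  obtain s where s: "\<sigma>' < s" "s < 1"
    using dense[OF lim(2)] by auto
  \<comment> \<open>Truncating the exponents at \<open>s\<close> gives one majorant for all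
    \<open>n\<close> and changes only finitely many terms.\<close>
  define \<tau> where "\<tau> n = min (\<sigma> n) s" for n
  have \<tau>: "\<tau> \<longlonglongrightarrow> \<sigma>'"
    unfolding \<tau>_def using tendsto_min[OF lim(1) tendsto_const[of s]] s by simp
  let ?w = "\<lambda>z::'a. ennreal C * (ennreal (rker (s - 1) z) * indicator {..<r} (norm z))"
  have "(\<lambda>n. \<integral>\<^sup>+z. ennreal (rker (\<tau> n) z) * indicator {..<r} (norm z) * f z \<partial>lborel)
    \<longlonglongrightarrow> (\<integral>\<^sup>+z. ennreal (rker \<sigma>' z) * indicator {..<r} (norm z) * f z \<partial>lborel)"
  proof (rule nn_integral_dominated_convergence[where w = ?w])
    show "AE z in lborel. ennreal (rker (\<tau> n) z) * indicator {..<r} (norm z) * f z \<le> ?w z" for n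
    proof (rule AE_I2)
      fix z :: 'a
      have "ennreal (rker (\<tau> n) z) * f z \<le> ennreal C * ennreal (rker (s - 1) z)" if z: "norm z < r"
      proof (cases "z = 0")
        case False
        \<comment> \<open>For \<open>norm z < 1\<close> the kernel increases with its order.\<close>
        have "rker (\<tau> n) z \<le> rker s z"
          unfolding rker_def using z r False
          by (intro divide_left_mono powr_mono' mult_pos_pos) (auto simp: \<tau>_def)
        then have "ennreal (rker (\<tau> n) z) * f z \<le> ennreal (rker s z) * ennreal (C * norm z)"
          by (intro mult_mono bound ennreal_leI) auto
        also have "\<dots> = ennreal C * ennreal (rker s z * norm z)"
          using \<open>0 \<le> C\<close> by (simp add: ennreal_mult[symmetric] mult.left_commute)
        finally show ?thesis
          by (simp only: rker_times_norm)
      qed simp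
      then show "ennreal (rker (\<tau> n) z) * indicator {..<r} (norm z) * f z \<le> ?w z"
        by (auto split: split_indicator)
    qed
    show "(\<integral>\<^sup>+z. ?w z \<partial>lborel) < \<infinity>"
      using nn_integral_rker_inside[of r "s - 1", where 'a = 'a] r s
      by (simp add: nn_integral_cmult ennreal_mult_less_top)
    show "AE z in lborel. (\<lambda>n. ennreal (rker (\<tau> n) z) * indicator {..<r} (norm z) * f z)
        \<longlonglongrightarrow> ennreal (rker \<sigma>' z) * indicator {..<r} (norm z) * f z"
    proof (rule AE_I2)
      fix z :: 'a
      have "f z < top"
        using bound(1)[of z] by (rule order.strict_trans1) simp
      then have "indicator {..<r} (norm z) * f z < top"
        by (auto split: split_indicator)
      then have "(\<lambda>n. indicator {..<r} (norm z) * f z * ennreal (rker (\<tau> n) z))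
        \<longlonglongrightarrow> indicator {..<r} (norm z) * f z * ennreal (rker \<sigma>' z)"
        by (intro ennreal_tendsto_cmult tendsto_ennrealI rker_tendsto \<tau>)
      then show "(\<lambda>n. ennreal (rker (\<tau> n) z) * indicator {..<r} (norm z) * f z)
        \<longlonglongrightarrow> ennreal (rker \<sigma>' z) * indicator {..<r} (norm z) * f z"
        by (simp add: mult.commute mult.left_commute)
    qed
  qed measurable
  moreover have "\<forall>\<^sub>F n in sequentially.
      (\<integral>\<^sup>+z. ennreal (rker (\<tau> n) z) * indicator {..<r} (norm z) * f z \<partial>lborel) =
      (\<integral>\<^sup>+z. ennreal (rker (\<sigma> n) z) * indicator {..<r} (norm z) * f z \<partial>lborel)"
    using order_tendstoD(2)[OF lim(1) s(1)] by eventually_elim (simp add: \<tau>_def)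
  ultimately show ?thesis
    by (rule Lim_transform_eventually)
qed

section \<open>Choice of a good level\<close>

text \<open>The average of the near parts over all levels is at most \<open>h\<close> for
  \<open>\<sigma>'\<close>, and by continuity little more for \<open>\<sigma> n\<close>. Hence some
  level has near part at most \<open>h + \<eta>\<close>, and it can be taken far enough from 0 and
  \<beta> for its superlevel set to be close to \<open>E\<close>.\<close>

lemma recovery_step:
  fixes E :: "'a::euclidean_space set"
  assumes [measurable]: "E \<in> sets borel" and fin: "emeasure lborel E < \<infinity>"
    and r: "0 < r" "r < 1" and lim: "\<sigma> \<longlonglongrightarrow> \<sigma>'" "\<sigma>' < 1"
    and h: "interaction \<sigma>' {..<r} E (- E) = ennreal h" "0 \<le> h" and "0 < \<eta>"
  shows "\<forall>\<^sub>F n in sequentially. \<exists>F\<in>sets borel. emeasure lborel F < \<infinity> \<and>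
    measure lborel (sym_diff F E) \<le> \<eta> \<and> interaction (\<sigma> n) {..<r} F (- F) \<le> ennreal (h + \<eta>)"
proof -
  \<comment> \<open>With this choice the discarded levels cost a quarter of \<open>\<eta>\<close>:
    \<open>(h + \<eta>) * (1 - 2 * \<delta>)\<close> equals \<open>h + 3 * \<eta> / 4\<close>, still
    above \<open>h + \<eta> / 2\<close>.\<close>
  define \<delta> where "\<delta> = \<eta> / (8 * (h + \<eta>))"
  have "(h + \<eta>) * \<delta> = \<eta> / 8"
    using \<open>0 < \<eta>\<close> \<open>0 \<le> h\<close> by (simp add: \<delta>_def del: distrib_left_numeral)
  then have "h + \<eta> / 2 < (h + \<eta>) * (1 - 2 * \<delta>)"
    using \<open>0 < \<eta>\<close> by (simp add: algebra_simps)
  moreover have "0 < \<delta>" "\<delta> < 1 / 2"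
    using \<open>0 < \<eta>\<close> \<open>0 \<le> h\<close> by (auto simp: \<delta>_def field_simps)
  ultimately have \<delta>: "0 < \<delta>" "\<delta> < 1 / 2" "h + \<eta> / 2 < (h + \<eta>) * (1 - 2 * \<delta>)"
    by auto
  \<comment> \<open>Each half of the symmetric difference will have measure at most
    \<open>\<kappa> / \<delta>\<close>, which is \<open>\<eta> / 2\<close>.\<close>
  define \<kappa> where "\<kappa> = \<delta> * \<eta> / 2"
  have \<kappa>: "0 < \<kappa>" "\<kappa> / \<delta> = \<eta> / 2"
    using \<delta> \<open>0 < \<eta>\<close> by (auto simp: \<kappa>_def)
  obtain \<epsilon> where \<epsilon>: "0 < \<epsilon>" "\<And>z. norm z < \<epsilon> \<Longrightarrow> corr E (- E) z \<le> ennreal \<kappa>"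
    using corr_compl_small[OF assms(1) fin \<kappa>(1)] by blast
  define \<beta> where "\<beta> = measure lborel (ball (0::'a) \<epsilon>)"
  have \<beta>: "emeasure lborel (ball (0::'a) \<epsilon>) = ennreal \<beta>" "0 < \<beta>"
    using \<epsilon> emeasure_lborel_ball_finite[of "0::'a" \<epsilon>]
    by (simp_all add: \<beta>_def emeasure_eq_ennreal_measure)
  define u where "u = convol (indicator E) (indicator (ball (0::'a) \<epsilon>))"
  have [measurable]: "u \<in> borel_measurable borel"
    unfolding u_def by measurable
  note drop = drop_integral_mollified[OF assms(1) fin \<epsilon>(1), folded u_def]
  let ?L = "\<lambda>t. {x. ennreal t < u x}"
  let ?A = "\<lambda>s. \<integral>\<^sup>+z. ennreal (rker s z) * indicator {..<r} (norm z) * drop_integral u z \<partial>lborel"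
  let ?m = "measure lborel E"
  let ?C = "?m * (unit_ball_vol DIM('a) * (real DIM('a) * \<epsilon> ^ (DIM('a) - 1)))"
  have m: "emeasure lborel E = ennreal ?m"
    using fin by (simp add: emeasure_eq_ennreal_measure)
  have "(\<lambda>n. ?A (\<sigma> n)) \<longlonglongrightarrow> ?A \<sigma>'"
  proof (rule weighted_drop_tendsto[where C = ?C])
    show "drop_integral u z \<le> ennreal (?C * norm z)" for z
      using drop(3)[of z] \<epsilon>(1) by (simp add: m ennreal_mult'[symmetric] mult.assoc)
    show "0 \<le> ?C"
      using \<epsilon>(1) by simp
  qed (use r lim in auto)
  \<comment> \<open>At \<open>\<sigma>'\<close> the integral is at most \<open>\<beta> * h\<close>;
    the strict gap lets the bound persist for large \<open>n\<close>.\<close>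
  moreover have "?A \<sigma>' < ennreal (\<beta> * (h + \<eta> / 2))"
  proof -
    have "?A \<sigma>' \<le> (\<integral>\<^sup>+z. ennreal \<beta> * (ennreal (rker \<sigma>' z) * indicator {..<r} (norm z) * corr E (- E) z) \<partial>lborel)"
    proof (intro nn_integral_mono)
      fix z
      have "ennreal (rker \<sigma>' z) * indicator {..<r} (norm z) * drop_integral u z \<le>
        ennreal (rker \<sigma>' z) * indicator {..<r} (norm z) * (ennreal \<beta> * corr E (- E) z)"
        using drop(2)[of z] by (intro mult_left_mono) (simp_all add: \<beta>)
      then show "ennreal (rker \<sigma>' z) * indicator {..<r} (norm z) * drop_integral u z \<le>
        ennreal \<beta> * (ennreal (rker \<sigma>' z) * indicator {..<r} (norm z) * corr E (- E) z)"
        by (simp add: mult.left_commute)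
    qed
    also have "\<dots> = ennreal \<beta> * interaction \<sigma>' {..<r} E (- E)"
      unfolding interaction_def by (intro nn_integral_cmult) measurable
    also have "\<dots> = ennreal (\<beta> * h)"
      using h \<beta> by (simp add: ennreal_mult)
    also have "\<dots> < ennreal (\<beta> * (h + \<eta> / 2))"
      using \<beta> h \<open>0 < \<eta>\<close> by (intro ennreal_lessI mult_pos_pos mult_strict_left_mono) auto
    finally show ?thesis .
  qed
  ultimately have "\<forall>\<^sub>F n in sequentially. ?A (\<sigma> n) < ennreal (\<beta> * (h + \<eta> / 2))"
    by (rule order_tendstoD)
  then show ?thesis
  proof eventually_elim
    case (elim n)
    let ?T = "{\<delta> * \<beta>..(1 - \<delta>) * \<beta>}"
    \<comment> \<open>The central levels have total length
      \<open>(1 - 2 * \<delta>) * \<beta>\<close>; near parts above \<open>h + \<eta>\<close> on all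
      of them would exceed the integral allowed by \<open>coarea_le\<close>.\<close>
    have "\<exists>t\<in>?T. interaction (\<sigma> n) {..<r} (?L t) (- ?L t) \<le> ennreal (h + \<eta>)"
    proof (rule ccontr)
      assume neg: "\<not> ?thesis"
      have gt: "ennreal (h + \<eta>) \<le> interaction (\<sigma> n) {..<r} (?L t) (- ?L t)" if "t \<in> ?T" for t
        using neg linear that by blast
      have "0 \<le> \<delta> * \<beta>"
        using \<delta> \<beta> by simp
      have "\<delta> * \<beta> \<le> (1 - \<delta>) * \<beta>"
        using \<delta> \<beta> by (intro mult_right_mono) auto
      have "ennreal (\<beta> * (h + \<eta> / 2)) \<le> ennreal ((h + \<eta>) * ((1 - \<delta>) * \<beta> - \<delta> * \<beta>))"
      proof (rule ennreal_leI)
        have "\<beta> * (h + \<eta> / 2) \<le> \<beta> * ((h + \<eta>) * (1 - 2 * \<delta>))"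
          using \<delta>(3) \<beta> by (intro mult_left_mono) auto
        then show "\<beta> * (h + \<eta> / 2) \<le> (h + \<eta>) * ((1 - \<delta>) * \<beta> - \<delta> * \<beta>)"
          by (simp add: algebra_simps)
      qed
      also have "\<dots> = (\<integral>\<^sup>+t. ennreal (h + \<eta>) * indicator ?T t \<partial>lborel)"
        using \<open>\<delta> * \<beta> \<le> (1 - \<delta>) * \<beta>\<close> h \<open>0 < \<eta>\<close>
        by (simp add: nn_integral_cmult_indicator ennreal_mult)
      also have "\<dots> \<le> (\<integral>\<^sup>+t. interaction (\<sigma> n) {..<r} (?L t) (- ?L t) * indicator {0..} t \<partial>lborel)"
      proof (intro nn_integral_mono)
        fix t :: real
        show "ennreal (h + \<eta>) * indicator ?T t \<le> interaction (\<sigma> n) {..<r} (?L t) (- ?L t) * indicator {0..} t"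
        proof (cases "t \<in> ?T")
          case True
          then have "0 \<le> t"
            using \<open>0 \<le> \<delta> * \<beta>\<close> by simp
          with gt[OF True] True show ?thesis
            by simp
        qed simp
      qed
      also have "\<dots> \<le> ?A (\<sigma> n)"
        by (rule coarea_le) (use drop(1) in measurable)
      finally show False
        using elim by simp
    qed
    then obtain t where t: "\<delta> * \<beta> \<le> t" "t \<le> (1 - \<delta>) * \<beta>"
      and I: "interaction (\<sigma> n) {..<r} (?L t) (- ?L t) \<le> ennreal (h + \<eta>)"
      by auto
    have close: "emeasure lborel (?L t - E) \<le> ennreal (\<eta> / 2)" "emeasure lborel (E - ?L t) \<le> ennreal (\<eta> / 2)"
      using level_set_close[OF assms(1) \<epsilon>(2,1) \<delta>(1) less_imp_le[OF \<kappa>(1)], folded \<beta>_def u_def, OF _ t]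
      by (simp_all only: \<kappa>(2))
    have "emeasure lborel (?L t) \<le> emeasure lborel (E \<union> (?L t - E))"
      by (intro emeasure_mono) auto
    also have "\<dots> \<le> emeasure lborel E + emeasure lborel (?L t - E)"
      by (intro emeasure_subadditive) measurable
    also have "\<dots> < \<infinity>"
      using fin le_less_trans[OF close(1) ennreal_less_top] by simp
    finally have finL: "emeasure lborel (?L t) < \<infinity>" .
    have "emeasure lborel (sym_diff (?L t) E) \<le> emeasure lborel (?L t - E) + emeasure lborel (E - ?L t)"
      by (intro emeasure_subadditive) measurable
    also have "\<dots> \<le> ennreal (\<eta> / 2) + ennreal (\<eta> / 2)"
      by (intro add_mono close)
    also have "\<dots> = ennreal \<eta>"
      using \<open>0 < \<eta>\<close> by (simp flip: ennreal_plus)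
    finally have "measure lborel (sym_diff (?L t) E) \<le> \<eta>"
      using \<open>0 < \<eta>\<close> unfolding measure_def by (intro enn2real_leI) auto
    with finL I show ?case
      by (intro bexI[of _ "?L t"]) auto
  qed
qed

section \<open>From Borel sets to measurable sets\<close>

text \<open>Stage \<open>n\<close> uses the smallest tolerance \<open>1 / (k + 1)\<close> with
  \<open>k \<le> n\<close> that admits a witness. A given tolerance of this form is available for
  large \<open>n\<close>, and monotonicity in \<open>\<eta>\<close> transfers the property to
  it.\<close>

lemma diagonal_sequence:
  fixes P :: "real \<Rightarrow> nat \<Rightarrow> 'b \<Rightarrow> bool"
  assumes ev: "\<And>\<eta>. 0 < \<eta> \<Longrightarrow> \<forall>\<^sub>F n in sequentially. \<exists>x. P \<eta> n x"
    and mono: "\<And>\<eta> \<eta>' n x. P \<eta> n x \<Longrightarrow> \<eta> \<le> \<eta>' \<Longrightarrow> P \<eta>' n x"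
    and Q: "Q x0" "\<And>\<eta> n x. P \<eta> n x \<Longrightarrow> Q x"
  obtains f where "\<And>n. Q (f n)" "\<And>\<eta>. 0 < \<eta> \<Longrightarrow> \<forall>\<^sub>F n in sequentially. P \<eta> n (f n)"
proof -
  \<comment> \<open>The bound \<open>k \<le> n\<close> keeps \<open>S n\<close> finite, so its
    maximum exists when it is nonempty; otherwise the default \<open>x0\<close> still satisfies
    \<open>Q\<close>.\<close>
  define S where "S n = {k. k \<le> n \<and> (\<exists>x. P (1 / real (Suc k)) n x)}" for n
  define f where "f n = (if S n = {} then x0 else SOME x. P (1 / real (Suc (Max (S n)))) n x)" for n
  have fin: "finite (S n)" for n
    unfolding S_def by simp
  have f: "P (1 / real (Suc (Max (S n)))) n (f n)" if "S n \<noteq> {}" for n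
  proof -
    have "Max (S n) \<in> S n"
      using fin that by (rule Max_in)
    then have "\<exists>x. P (1 / real (Suc (Max (S n)))) n x"
      unfolding S_def by blast
    then show ?thesis
      using that unfolding f_def by (simp add: someI_ex del: of_nat_Suc)
  qed
  show thesis
  proof (rule that)
    show "Q (f n)" for n
      using f[of n] Q by (cases "S n = {}") (auto simp: f_def)
    fix \<eta> :: real assume "0 < \<eta>"
    then obtain k where k: "1 / real (Suc k) < \<eta>"
      using nat_approx_posE by blast
    have "\<forall>\<^sub>F n in sequentially. \<exists>x. P (1 / real (Suc k)) n x"
      by (rule ev) simp
    then show "\<forall>\<^sub>F n in sequentially. P \<eta> n (f n)"
      using eventually_ge_at_top[of k]
    proof eventually_elim
      case (elim n)
      then have k': "k \<in> S n"
        by (auto simp: S_def)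
      then have "k \<le> Max (S n)"
        using fin by simp
      then have "1 / real (Suc (Max (S n))) \<le> \<eta>"
        using k by (intro order_trans[OF _ less_imp_le[OF k]] divide_left_mono) auto
      with f[of n] k' mono show ?case
        by blast
    qed
  qed
qed

section \<open>Replacing measurable sets by Borel sets\<close>

lemma nn_integral_double_cong_AE:
  assumes "AE x in M. x \<in> A \<longleftrightarrow> x \<in> B" "\<And>x. AE y in M. y \<in> S x \<longleftrightarrow> y \<in> T x"
  shows "(\<integral>\<^sup>+x\<in>A. (\<integral>\<^sup>+y\<in>S x. k x y \<partial>M) \<partial>M) = (\<integral>\<^sup>+x\<in>B. (\<integral>\<^sup>+y\<in>T x. k x y \<partial>M) \<partial>M)"
proof -
  have "(\<integral>\<^sup>+y\<in>S x. k x y \<partial>M) = (\<integral>\<^sup>+y\<in>T x. k x y \<partial>M)" for x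
  proof (rule nn_integral_cong_AE)
    show "AE y in M. k x y * indicator (S x) y = k x y * indicator (T x) y"
      using assms(2)[of x] by eventually_elim (simp add: indicator_def)
  qed
  moreover have "AE x in M. (\<integral>\<^sup>+y\<in>T x. k x y \<partial>M) * indicator A x = (\<integral>\<^sup>+y\<in>T x. k x y \<partial>M) * indicator B x"
    using assms(1) by eventually_elim (simp add: indicator_def)
  ultimately show ?thesis
    by (simp add: nn_integral_cong_AE)
qed

text \<open>All the integrals involved ignore null sets. Lebesgue measurable sets can thus be
  replaced by Borel ones, on which correlations are Borel functions.\<close>

lemma Hhat_cong_AE:
  fixes A B :: "'a::euclidean_space set"
  assumes "A \<in> sets lebesgue" "B \<in> sets lebesgue" and ae: "AE x in lebesgue. x \<in> A \<longleftrightarrow> x \<in> B"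
  shows "Hhat \<sigma> R A = Hhat \<sigma> R B"
proof -
  have meas: "measure lebesgue A = measure lebesgue B"
    using ae assms by (intro measure_eq_AE) auto
  have ae': "AE y in lebesgue. y \<in> ball x r - A \<longleftrightarrow> y \<in> ball x r - B"
    "AE y in lebesgue. y \<in> A - ball x r \<longleftrightarrow> y \<in> B - ball x r"
    "AE y in lebesgue. y \<in> - A \<longleftrightarrow> y \<in> - B" for x r
    using ae by (auto elim!: eventually_mono)
  have H: "H_R s r A = H_R s r B" for s r
    unfolding H_R_def by (intro nn_integral_double_cong_AE ae ae')
  have
    "(\<integral>\<^sup>+x\<in>A. (\<integral>\<^sup>+y\<in>- A. k x y \<partial>lebesgue) \<partial>lebesgue) = (\<integral>\<^sup>+x\<in>B. (\<integral>\<^sup>+y\<in>- B. k x y \<partial>lebesgue) \<partial>lebesgue)"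
    "(\<integral>\<^sup>+x\<in>A. (\<integral>\<^sup>+y\<in>A. k x y \<partial>lebesgue) \<partial>lebesgue) = (\<integral>\<^sup>+x\<in>B. (\<integral>\<^sup>+y\<in>B. k x y \<partial>lebesgue) \<partial>lebesgue)"
    "(\<integral>\<^sup>+x\<in>A. (\<integral>\<^sup>+y\<in>ball x 1 - A. k x y \<partial>lebesgue) \<partial>lebesgue) =
      (\<integral>\<^sup>+x\<in>B. (\<integral>\<^sup>+y\<in>ball x 1 - B. k x y \<partial>lebesgue) \<partial>lebesgue)"
    "(\<integral>\<^sup>+x\<in>A. (\<integral>\<^sup>+y\<in>A - ball x 1. k x y \<partial>lebesgue) \<partial>lebesgue) =
      (\<integral>\<^sup>+x\<in>B. (\<integral>\<^sup>+y\<in>B - ball x 1. k x y \<partial>lebesgue) \<partial>lebesgue)" for k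
    by (intro nn_integral_double_cong_AE ae ae')+
  then show ?thesis
    unfolding Hhat_def Hhat_R_def Hhat_inf_def by (simp only: H meas)
qed

lemma L1_converges_cong_AE:
  assumes "\<And>n. AE x in lebesgue. x \<in> F n \<longleftrightarrow> x \<in> F' n" "AE x in lebesgue. x \<in> E \<longleftrightarrow> x \<in> E'"
  shows "L1_converges (\<lambda>n. indicat_real (F n)) (indicat_real E) \<longleftrightarrow>
    L1_converges (\<lambda>n. indicat_real (F' n)) (indicat_real E')"
proof -
  have "(\<integral>\<^sup>+x. ennreal \<bar>indicat_real (F n) x - indicat_real E x\<bar> \<partial>lebesgue) =
      (\<integral>\<^sup>+x. ennreal \<bar>indicat_real (F' n) x - indicat_real E' x\<bar> \<partial>lebesgue)" for n
  proof (rule nn_integral_cong_AE)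
    show "AE x in lebesgue. ennreal \<bar>indicat_real (F n) x - indicat_real E x\<bar> =
        ennreal \<bar>indicat_real (F' n) x - indicat_real E' x\<bar>"
      using assms(1)[of n] assms(2) by eventually_elim (simp add: indicator_def)
  qed
  then show ?thesis
    unfolding L1_converges_def by simp
qed

text \<open>The modulus of the difference of two indicators is the indicator of the symmetric
  difference, whose measure is finite here.\<close>

lemma L1_converges_indicator_iff:
  fixes E :: "'a::euclidean_space set"
  assumes [measurable]: "E \<in> sets borel" "\<And>n. F n \<in> sets borel"
    and fin: "emeasure lborel E < \<infinity>" "\<And>n. emeasure lborel (F n) < \<infinity>"
  shows "L1_converges (\<lambda>n. indicat_real (F n)) (indicat_real E) \<longleftrightarrow>
    (\<lambda>n. measure lborel (sym_diff (F n) E)) \<longlonglongrightarrow> 0"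
proof -
  have "(\<integral>\<^sup>+x. ennreal \<bar>indicat_real (F n) x - indicat_real E x\<bar> \<partial>lebesgue) =
      ennreal (measure lborel (sym_diff (F n) E))" for n
  proof -
    have "E \<in> fmeasurable lborel" "F n \<in> fmeasurable lborel"
      using fin by (auto simp: fmeasurable_def)
    then have "sym_diff (F n) E \<in> fmeasurable lborel"
      by (intro fmeasurable.Un fmeasurable.Diff) auto
    moreover have "(\<integral>\<^sup>+x. ennreal \<bar>indicat_real (F n) x - indicat_real E x\<bar> \<partial>lebesgue) =
        (\<integral>\<^sup>+x. indicator (sym_diff (F n) E) x \<partial>lborel)"
      unfolding nn_integral_completion
      by (intro nn_integral_cong) (auto split: split_indicator)
    ultimately show ?thesis
      by (simp add: emeasure_eq_measure2)
  qed
  then show ?thesis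
    unfolding L1_converges_def
    using tendsto_ennreal_iff[of "\<lambda>n. measure lborel (sym_diff (F n) E)" sequentially 0] by simp
qed

text \<open>A Lebesgue measurable set is an \<open>fsigma\<close> set up to a null set, and
  \<open>fsigma\<close> sets are Borel.\<close>

lemma lmeasurable_borel_version:
  fixes E :: "'a::euclidean_space set"
  assumes "E \<in> lmeasurable"
  obtains E' where "E' \<in> sets borel" "emeasure lborel E' < \<infinity>" "AE x in lebesgue. x \<in> E \<longleftrightarrow> x \<in> E'"
proof -
  have E: "E \<in> sets lebesgue"
    using assms by (rule fmeasurableD)
  obtain C T where CT: "fsigma C" "T \<in> null_sets lebesgue" "C \<union> T = E" "disjnt C T"
    by (rule lebesgue_set_almost_fsigma[OF E])
  have C: "C \<in> sets borel"
    using CT(1)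
  proof (cases rule: fsigma.cases)
    case (1 F)
    then show ?thesis
      by (auto intro!: borel_closed)
  qed
  have ae: "AE x in lebesgue. x \<in> E \<longleftrightarrow> x \<in> C"
    using AE_not_in[OF CT(2)] by eventually_elim (use CT(3) in auto)
  have "emeasure lborel C = emeasure lebesgue E"
    using emeasure_eq_AE[OF ae E] C by simp
  also have "\<dots> < \<infinity>"
    using fmeasurableD2[OF assms] by (simp add: less_top)
  finally show thesis
    using that C ae by blast
qed

lemma lmeasurable_borel:
  assumes "F \<in> sets borel" "emeasure lborel F < \<infinity>"
  shows "F \<in> lmeasurable"
  using assms by (intro fmeasurableI) auto

lemma liminf_Hhat:
  fixes E :: "'a::euclidean_space set"
  assumes E: "E \<in> lmeasurable" and F: "\<And>n. F n \<in> lmeasurable"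
    and conv: "L1_converges (\<lambda>n. indicat_real (F n)) (indicat_real E)"
    and R: "0 < R'" and s: "\<And>n. - real DIM('a) < \<sigma> n" "\<And>n. \<sigma> n < 1"
    and lim: "\<sigma> \<longlonglongrightarrow> \<sigma>'" "R \<longlonglongrightarrow> R'" and s': "- real DIM('a) < \<sigma>'" "\<sigma>' < 1"
  shows "Hhat \<sigma>' R' E \<le> liminf (\<lambda>n. Hhat (\<sigma> n) (R n) (F n))"
proof -
  obtain E' where E': "E' \<in> sets borel" "emeasure lborel E' < \<infinity>" "AE x in lebesgue. x \<in> E \<longleftrightarrow> x \<in> E'"
    by (rule lmeasurable_borel_version[OF E])
  have "\<exists>F'. F' \<in> sets borel \<and> emeasure lborel F' < \<infinity> \<and> (AE x in lebesgue. x \<in> F n \<longleftrightarrow> x \<in> F')" for n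
    by (rule lmeasurable_borel_version[OF F[of n]]) blast
  then obtain F' where F': "\<And>n. F' n \<in> sets borel" "\<And>n. emeasure lborel (F' n) < \<infinity>"
    "\<And>n. AE x in lebesgue. x \<in> F n \<longleftrightarrow> x \<in> F' n"
    by metis
  have "L1_converges (\<lambda>n. indicat_real (F' n)) (indicat_real E')"
    using conv L1_converges_cong_AE[OF F'(3) E'(3)] by simp
  then have "(\<lambda>n. measure lborel (sym_diff (F' n) E')) \<longlonglongrightarrow> 0"
    using L1_converges_indicator_iff[OF E'(1) F'(1) E'(2) F'(2)] by simp
  then have "Hhat \<sigma>' R' E' \<le> liminf (\<lambda>n. Hhat (\<sigma> n) (R n) (F' n))"
    by (rule liminf_Hhat_borel[OF E'(1) F'(1) E'(2) F'(2) _ R s lim s'])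
  moreover have "Hhat \<sigma>' R' E = Hhat \<sigma>' R' E'"
    using E E' by (intro Hhat_cong_AE) auto
  moreover have "Hhat (\<sigma> n) (R n) (F n) = Hhat (\<sigma> n) (R n) (F' n)" for n
    using F F' by (intro Hhat_cong_AE) auto
  ultimately show ?thesis
    by simp
qed

section \<open>Recovery sequences and conclusion\<close>

text \<open>The diagonal sequence eventually keeps the near part below \<open>h + \<eta>\<close> for
  each \<open>\<eta>\<close>, and the far part is continuous along it.\<close>

lemma recovery_sequence_borel:
  fixes E :: "'a::euclidean_space set"
  assumes E: "E \<in> sets borel" "emeasure lborel E < \<infinity>" and finH: "Hhat \<sigma>' R' E \<noteq> \<infinity>"
    and R: "0 < R'" and s: "\<And>n. - real DIM('a) < \<sigma> n" "\<And>n. \<sigma> n < 1"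
    and lim: "\<sigma> \<longlonglongrightarrow> \<sigma>'" "R \<longlonglongrightarrow> R'" and s': "- real DIM('a) < \<sigma>'" "\<sigma>' < 1"
  obtains F where "\<forall>n. F n \<in> sets borel" "\<forall>n. emeasure lborel (F n) < \<infinity>"
    "(\<lambda>n. measure lborel (sym_diff (F n) E)) \<longlonglongrightarrow> 0"
    "limsup (\<lambda>n. Hhat (\<sigma> n) (R n) (F n)) \<le> Hhat \<sigma>' R' E"
proof -
  obtain r where r: "0 < r" "r < 1" "ereal r < R'"
    by (rule radius_below[OF R])
  have dec: "Hhat \<sigma>' R' E = enn2ereal (interaction \<sigma>' {..<r} E (- E)) + ereal (far_part \<sigma>' r R' E)"
    by (rule Hhat_decomp[OF E r s'])
  \<comment> \<open>The far part is real, so a finite functional forces a finite near part.\<close>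
  then have "interaction \<sigma>' {..<r} E (- E) \<noteq> top"
    using finH by auto
  then obtain h where h: "interaction \<sigma>' {..<r} E (- E) = ennreal h" "0 \<le> h"
    by (metis ennreal_cases)
  define P where "P \<eta> n F \<longleftrightarrow> F \<in> sets borel \<and> emeasure lborel F < \<infinity> \<and>
    measure lborel (sym_diff F E) \<le> \<eta> \<and> interaction (\<sigma> n) {..<r} F (- F) \<le> ennreal (h + \<eta>)"
    for \<eta> n and F :: "'a set"
  obtain F where Q: "\<And>n. F n \<in> sets borel \<and> emeasure lborel (F n) < \<infinity>"
    and P: "\<And>\<eta>. 0 < \<eta> \<Longrightarrow> \<forall>\<^sub>F n in sequentially. P \<eta> n (F n)"
  proof (rule diagonal_sequence[of P "\<lambda>F. F \<in> sets borel \<and> emeasure lborel F < \<infinity>" E])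
    show "\<forall>\<^sub>F n in sequentially. \<exists>F. P \<eta> n F" if "0 < \<eta>" for \<eta>
      using recovery_step[OF E r(1,2) lim(1) s'(2) h that] unfolding P_def
      by (rule eventually_mono) blast
    show "P \<eta>' n F" if "P \<eta> n F" "\<eta> \<le> \<eta>'" for \<eta> \<eta>' n F
    proof -
      have "ennreal (h + \<eta>) \<le> ennreal (h + \<eta>')"
        using that(2) by (intro ennreal_leI) simp
      with that show ?thesis
        unfolding P_def by (meson order_trans)
    qed
  qed (use E in \<open>auto simp: P_def\<close>)
  have conv: "(\<lambda>n. measure lborel (sym_diff (F n) E)) \<longlonglongrightarrow> 0"
  proof (rule tendstoI)
    fix e :: real assume "0 < e"
    then have "0 < e / 2"
      by simp
    from P[OF this] show "\<forall>\<^sub>F n in sequentially. dist (measure lborel (sym_diff (F n) E)) 0 < e"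
      by eventually_elim (use \<open>0 < e\<close> in \<open>auto simp: P_def\<close>)
  qed
  have far: "(\<lambda>n. far_part (\<sigma> n) r (R n) (F n)) \<longlonglongrightarrow> far_part \<sigma>' r R' E"
    by (rule far_part_tendsto[OF E(1) Q[THEN conjunct1] E(2) Q[THEN conjunct2] conv r(1,2) s lim s'])
  have "limsup (\<lambda>n. Hhat (\<sigma> n) (R n) (F n)) \<le> Hhat \<sigma>' R' E + ereal \<eta>" if "0 < \<eta>" for \<eta>
  proof -
    have "limsup (\<lambda>n. Hhat (\<sigma> n) (R n) (F n)) \<le> limsup (\<lambda>n. ereal (h + \<eta> + far_part (\<sigma> n) r (R n) (F n)))"
    proof (rule Limsup_mono)
      show "\<forall>\<^sub>F n in sequentially. Hhat (\<sigma> n) (R n) (F n) \<le> ereal (h + \<eta> + far_part (\<sigma> n) r (R n) (F n))"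
        using P[OF that] order_tendstoD(1)[OF lim(2) r(3)]
      proof eventually_elim
        case (elim n)
        have "Hhat (\<sigma> n) (R n) (F n) =
            enn2ereal (interaction (\<sigma> n) {..<r} (F n) (- F n)) + ereal (far_part (\<sigma> n) r (R n) (F n))"
          using Q elim by (intro Hhat_decomp r s) auto
        also have "\<dots> \<le> enn2ereal (ennreal (h + \<eta>)) + ereal (far_part (\<sigma> n) r (R n) (F n))"
          using elim by (intro add_right_mono) (simp add: P_def less_eq_ennreal.rep_eq)
        also have "\<dots> = ereal (h + \<eta> + far_part (\<sigma> n) r (R n) (F n))"
          using h that by (simp add: enn2ereal_ennreal del: ennreal_plus)
        finally show ?case .
      qed
    qed
    also have "\<dots> = ereal (h + \<eta> + far_part \<sigma>' r R' E)"
      by (intro lim_imp_Limsup tendsto_ereal tendsto_add tendsto_const far) simp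
    also have "\<dots> = Hhat \<sigma>' R' E + ereal \<eta>"
      unfolding dec h using h by (simp add: enn2ereal_ennreal)
    finally show ?thesis .
  qed
  then have "limsup (\<lambda>n. Hhat (\<sigma> n) (R n) (F n)) \<le> Hhat \<sigma>' R' E"
    by (rule ereal_le_epsilon2)
  then show thesis
    using Q conv by (intro that[of F]) simp_all
qed

theorem theorem6p3:
  fixes Rbar :: ereal and \<sigma>bar :: real
    and R :: "nat \<Rightarrow> ereal" and \<sigma> :: "nat \<Rightarrow> real"
  assumes "0 < Rbar"
    and "- real DIM('a::euclidean_space) < \<sigma>bar" and "\<sigma>bar < 1"
    and "\<And>n. 0 < R n"
    and "\<And>n. - real DIM('a) < \<sigma> n" and "\<And>n. \<sigma> n < 1"
    and "R \<longlonglongrightarrow> Rbar" and "\<sigma> \<longlonglongrightarrow> \<sigma>bar"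
  shows
    "(\<forall>E\<in>lmeasurable. \<forall>F :: nat \<Rightarrow> 'a set.
        (\<forall>n. F n \<in> lmeasurable) \<longrightarrow>
        L1_converges (\<lambda>n. indicat_real (F n)) (indicat_real E) \<longrightarrow>
        Hhat \<sigma>bar Rbar E \<le> liminf (\<lambda>n. Hhat (\<sigma> n) (R n) (F n)))
     \<and>
     (\<forall>E\<in>lmeasurable. \<exists>F :: nat \<Rightarrow> 'a set.
        (\<forall>n. F n \<in> lmeasurable) \<and>
        L1_converges (\<lambda>n. indicat_real (F n)) (indicat_real E) \<and>
        Hhat \<sigma>bar Rbar E \<ge> limsup (\<lambda>n. Hhat (\<sigma> n) (R n) (F n)))"
proof (intro conjI ballI allI impI)
  fix E and F :: "nat \<Rightarrow> 'a set"
  assume "E \<in> lmeasurable" "\<forall>n. F n \<in> lmeasurable"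
    "L1_converges (\<lambda>n. indicat_real (F n)) (indicat_real E)"
  then show "Hhat \<sigma>bar Rbar E \<le> liminf (\<lambda>n. Hhat (\<sigma> n) (R n) (F n))"
    using assms by (intro liminf_Hhat) auto
next
  fix E :: "'a set" assume E: "E \<in> lmeasurable"
  obtain E' where E': "E' \<in> sets borel" "emeasure lborel E' < \<infinity>" "AE x in lebesgue. x \<in> E \<longleftrightarrow> x \<in> E'"
    by (rule lmeasurable_borel_version[OF E])
  have eq: "Hhat \<sigma>bar Rbar E = Hhat \<sigma>bar Rbar E'"
    using E E' by (intro Hhat_cong_AE) auto
  show "\<exists>F :: nat \<Rightarrow> 'a set. (\<forall>n. F n \<in> lmeasurable) \<and>
      L1_converges (\<lambda>n. indicat_real (F n)) (indicat_real E) \<and>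
      limsup (\<lambda>n. Hhat (\<sigma> n) (R n) (F n)) \<le> Hhat \<sigma>bar Rbar E"
  \<comment> \<open>An infinite value imposes nothing on the limsup, so the constant sequence
    serves; otherwise the Borel version of \<open>E\<close> has finite value and its recovery
    sequence also serves for \<open>E\<close>.\<close>
  proof (cases "Hhat \<sigma>bar Rbar E = \<infinity>")
    case True
    then show ?thesis
      using E by (intro exI[of _ "\<lambda>_. E"]) (simp add: L1_converges_def)
  next
    case False
    with eq have finH: "Hhat \<sigma>bar Rbar E' \<noteq> \<infinity>"
      by simp
    obtain F where F: "\<forall>n. F n \<in> sets borel" "\<forall>n. emeasure lborel (F n) < \<infinity>"
      "(\<lambda>n. measure lborel (sym_diff (F n) E')) \<longlonglongrightarrow> 0"
      "limsup (\<lambda>n. Hhat (\<sigma> n) (R n) (F n)) \<le> Hhat \<sigma>bar Rbar E'"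
      by (rule recovery_sequence_borel[OF E'(1,2) finH assms(1,5,6,8,7,2,3)])
    have "L1_converges (\<lambda>n. indicat_real (F n)) (indicat_real E')"
      using L1_converges_indicator_iff[of E' F] E' F by simp
    then have "L1_converges (\<lambda>n. indicat_real (F n)) (indicat_real E)"
      using L1_converges_cong_AE[OF _ E'(3), of F F] by simp
    with F eq show ?thesis
      by (intro exI[of _ F]) (auto intro: lmeasurable_borel)
  qed
qed

end
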